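(* Let $i\in\{1,\dots,q\}$, $j\in\{1,\dots,p-q\}$ and let $d_{ij}=e_i^{\mathsf T}De_j$ and $\hat d_{ij}=e_i^{\mathsf T}\hat De_j$, where $D^{\mathsf T}=R_{I,1}R_{I,2}^{-1}$ and $\hat D^{\mathsf T}=\hat R_{I,1}\hat R_{I,2}^{-1}$. Define $$B_{ij}=\left(e_i^{\mathsf T}R_{I,2}^{-\mathsf T}\otimes e_j^{\mathsf T}\upsilon_\perp^{\mathsf T}R_J\right)\left[\left(\Lambda_I^{\mathsf T}\otimes I_{p-q}\right)-\left(I_q\otimes\Lambda_J\right)\right]^{-1}\left(R_I^{\mathsf T}\otimes L_J^{\mathsf T}\right),\qquad \upsilon_\perp^{\mathsf T}=[\,I_{p-q}\ \ -D^{\mathsf T}\,],$$ let $\hat B_{ij}$ be its sample analogue and $\hat\sigma_{ij}^2=\hat B_{ij}\hat\Omega\hat B_{ij}^{\mathsf T}$. Then, under the null hypothesis $d_{ij}=d_0$, as $T\to\infty$, $$t_{ij}(d_0)=\frac{\hat d_{ij}-d_0}{\sqrt{\hat\sigma_{ij}^2/T}}$$ converges in distribution to $N(0,1)$.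
   Context: Fix $p$ and $q<p$. The matrix $M\in\mathbb R^{p\times p}$ admits a nonsingular real matrix $R=[R_I\ R_J]$, $R_I\in\mathbb R^{p\times q}$, with $L=[L_I\ L_J]=R^{-\mathsf T}$ partitioned conformably, such that $$R^{-1}MR=\begin{bmatrix}\Lambda_I&\Lambda_{IJ}\\0&\Lambda_J\end{bmatrix},\quad \Lambda_I\in\mathbb R^{q\times q}.$$ The spectra of $\Lambda_I$ and $\Lambda_J$ are disjoint, the spectrum of $\Lambda_I$ is closed under complex conjugation, and, with the eigenvalues of $M$ ordered by decreasing modulus, it consists of $\lambda_1,\dots,\lambda_q$ with $|\lambda_q|>|\lambda_{q+1}|$. There is a full-rank normalizing matrix $G\in\mathbb R^{p\times q}$ with $\operatorname{rank}G^{\mathsf T}R_I=q$. Write $R_I=\begin{bmatrix}R_{I,1}\\R_{I,2}\end{bmatrix}$ with $R_{I,1}\in\mathbb R^{(p-q)\times q}$ and $R_{I,2}\in\mathbb R^{q\times q}$ of rank $q$. Vectors $e_i\in\mathbb R^q$, $e_j\in\mathbb R^{p-q}$ are standard basis vectors. Data: $M_t=M+\varepsilon_t$, $t=1,\dots,T$, where the $\operatorname{vec}\varepsilon_t$ are identically distributed with mean zero and positive-definite covariance $\Omega\in\mathbb R^{p^2\times p^2}$; $\hat M_T=T^{-1}\sum_tM_t$, and $\sqrt T\operatorname{vec}(\hat M_T-M)$ converges in distribution to $N(0,\Omega)$. $\hat\Omega$ is a consistent estimator of $\Omega$. Hatted quantities are sample analogues: the decomposition of $\hat M_T$ partitioned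 in the same way, obtained by evaluating at $\hat M_T$ maps $R(\cdot),L(\cdot),\Lambda(\cdot)$ that are smooth near $M$. *)

theory Defs
  imports "HOL-Probability.Probability"
begin

text \<open>
  Partitioned matrices are indexed by sum types. With \<^typ>\<open>'q\<close> of size \<open>q\<close> and \<^typ>\<open>'r\<close> of size
  \<open>p - q\<close>, the rows and columns of the \<open>p \<times> p\<close> matrix \<open>M\<close> are indexed by \<^typ>\<open>'r + 'q\<close> (the first
  \<open>p - q\<close> coordinates, then the last \<open>q\<close>), whereas the columns of \<open>R = [R\<^sub>I R\<^sub>J]\<close> are indexed by
  \<^typ>\<open>'q + 'r\<close>. Both index types have \<open>p\<close> elements, so that \<open>R\<close> is square although its row and
  column types differ; \<^const>\<open>invertible\<close> and \<^const>\<open>matrix_inv\<close> are defined at this generality.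
\<close>

definition left_cols :: "'a^('m::finite + 'n::finite)^'k \<Rightarrow> 'a^'m^'k" where
  "left_cols A = (\<chi> i j. A $ i $ Inl j)"

definition right_cols :: "'a^('m::finite + 'n::finite)^'k \<Rightarrow> 'a^'n^'k" where
  "right_cols A = (\<chi> i j. A $ i $ Inr j)"

definition upper_rows :: "'a^'k^('m::finite + 'n::finite) \<Rightarrow> 'a^'k^'m" where
  "upper_rows A = (\<chi> i. A $ Inl i)"

definition lower_rows :: "'a^'k^('m::finite + 'n::finite) \<Rightarrow> 'a^'k^'n" where
  "lower_rows A = (\<chi> i. A $ Inr i)"

definition hcat :: "'a^'m^'k \<Rightarrow> 'a^'n^'k \<Rightarrow> 'a^('m::finite + 'n::finite)^'k" where
  "hcat A B = (\<chi> i j. case j of Inl a \<Rightarrow> A $ i $ a | Inr b \<Rightarrow> B $ i $ b)"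

text \<open>
  Column stacking: the entry in row \<open>i\<close> and column \<open>j\<close> gets the index \<open>(j, i)\<close>. With the Kronecker
  product indexed as below this gives \<open>vec (A X B) = (B\<^sup>T \<otimes> A) vec X\<close>.
\<close>

definition vec_of :: "'a^'n::finite^'m::finite \<Rightarrow> 'a^('n \<times> 'm)" where
  "vec_of A = (\<chi> c. A $ snd c $ fst c)"

definition kron :: "'a::times^'n::finite^'m \<Rightarrow> 'a^'l::finite^'k \<Rightarrow> 'a^('n \<times> 'l)^('m \<times> 'k)" where
  "kron A B = (\<chi> r c. A $ fst r $ fst c * B $ snd r $ snd c)"

text \<open>The Kronecker product of two row vectors.\<close>

definition kron_vec :: "'a::times^'n::finite \<Rightarrow> 'a^'l::finite \<Rightarrow> 'a^('n \<times> 'l)" where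
  "kron_vec u v = (\<chi> c. u $ fst c * v $ snd c)"

definition eigvals :: "real^'n^'n \<Rightarrow> complex set" where
  "eigvals A = {z. \<exists>v. v \<noteq> 0 \<and> map_matrix complex_of_real A *v v = z *s v}"

text \<open>
  \<open>lam 1, \<dots>, lam p\<close> are the eigenvalues of \<open>A\<close>, repeated according to algebraic multiplicity and
  ordered by decreasing modulus; the remaining values of \<open>lam\<close> are irrelevant.
\<close>

definition eigenvalue_list :: "real^'n^'n \<Rightarrow> (nat \<Rightarrow> complex) \<Rightarrow> bool" where
  "eigenvalue_list A lam \<longleftrightarrow>
     (\<forall>z. det (mat z - map_matrix complex_of_real A) = (\<Prod>k=1..CARD('n). z - lam k)) \<and>
     (\<forall>k l. 1 \<le> k \<and> k \<le> l \<and> l \<le> CARD('n) \<longrightarrow> cmod (lam l) \<le> cmod (lam k))"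

definition block_decomp ::
  "real^('r::finite + 'q::finite)^('r + 'q) \<Rightarrow> real^('q + 'r)^('r + 'q) \<Rightarrow> real^('q + 'r)^('r + 'q)
    \<Rightarrow> real^('q + 'r)^('q + 'r) \<Rightarrow> bool" where
  "block_decomp N R L \<Lambda> \<longleftrightarrow>
     invertible R \<and> L = transpose (matrix_inv R) \<and> matrix_inv R ** N ** R = \<Lambda> \<and>
     lower_rows (left_cols \<Lambda>) = 0"

primrec times_differentiable_on ::
  "nat \<Rightarrow> 'a::real_normed_vector set \<Rightarrow> ('a \<Rightarrow> 'b::real_normed_vector) \<Rightarrow> bool" where
  "times_differentiable_on 0 U f \<longleftrightarrow> continuous_on U f"
| "times_differentiable_on (Suc n) U f \<longleftrightarrow>
     (\<forall>x\<in>U. f differentiable at x) \<and>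
     (\<forall>v. times_differentiable_on n U (\<lambda>x. frechet_derivative f (at x) v))"

text \<open>For open \<open>U\<close> and a finite-dimensional domain this is \<open>C\<^sup>\<infinity>\<close>.\<close>

definition smooth_on :: "'a::real_normed_vector set \<Rightarrow> ('a \<Rightarrow> 'b::real_normed_vector) \<Rightarrow> bool" where
  "smooth_on U f \<longleftrightarrow> (\<forall>n. times_differentiable_on n U f)"

definition D_mat :: "real^('q::finite + 'r::finite)^('r + 'q) \<Rightarrow> real^'r^'q" where
  "D_mat R = transpose (upper_rows (left_cols R) ** matrix_inv (lower_rows (left_cols R)))"

definition d_coef :: "'q::finite \<Rightarrow> 'r::finite \<Rightarrow> real^('q + 'r)^('r + 'q) \<Rightarrow> real" where
  "d_coef i j R = axis i 1 \<bullet> (D_mat R *v axis j 1)"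

definition upsilon_perp_T :: "real^('q::finite + 'r::finite)^('r + 'q) \<Rightarrow> real^('r + 'q)^'r" where
  "upsilon_perp_T R = hcat (mat 1) (- transpose (D_mat R))"

definition B_row ::
  "'q::finite \<Rightarrow> 'r::finite \<Rightarrow> real^('q + 'r)^('r + 'q) \<Rightarrow> real^('q + 'r)^('r + 'q) \<Rightarrow> real^('q + 'r)^('q + 'r)
    \<Rightarrow> real^(('r + 'q) \<times> ('r + 'q))" where
  "B_row i j R L \<Lambda> =
     kron_vec (axis i 1 v* transpose (matrix_inv (lower_rows (left_cols R))))
              (axis j 1 v* (upsilon_perp_T R ** right_cols R))
     v* matrix_inv (kron (transpose (upper_rows (left_cols \<Lambda>))) (mat 1)
                    - kron (mat 1) (lower_rows (right_cols \<Lambda>)))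
     v* kron (transpose (left_cols R)) (transpose (right_cols L))"

definition sigma2 ::
  "'q::finite \<Rightarrow> 'r::finite \<Rightarrow> real^('q + 'r)^('r + 'q) \<Rightarrow> real^('q + 'r)^('r + 'q) \<Rightarrow> real^('q + 'r)^('q + 'r)
    \<Rightarrow> real^(('r + 'q) \<times> ('r + 'q))^(('r + 'q) \<times> ('r + 'q)) \<Rightarrow> real" where
  "sigma2 i j R L \<Lambda> \<Omega> = (B_row i j R L \<Lambda> v* \<Omega>) \<bullet> B_row i j R L \<Lambda>"

definition positive_definite :: "real^'k^'k \<Rightarrow> bool" where
  "positive_definite S \<longleftrightarrow> transpose S = S \<and> (\<forall>v. v \<noteq> 0 \<longrightarrow> v \<bullet> (S *v v) > 0)"

definition has_mean :: "'w measure \<Rightarrow> ('w \<Rightarrow> real^'k) \<Rightarrow> real^'k \<Rightarrow> bool" where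
  "has_mean P X m \<longleftrightarrow> integrable P X \<and> (\<integral>\<omega>. X \<omega> \<partial>P) = m"

definition has_covariance :: "'w measure \<Rightarrow> ('w \<Rightarrow> real^'k) \<Rightarrow> real^'k^'k \<Rightarrow> bool" where
  "has_covariance P X S \<longleftrightarrow> integrable P X \<and>
     (let m = (\<integral>\<omega>. X \<omega> \<partial>P) in
      \<forall>k l. integrable P (\<lambda>\<omega>. (X \<omega> $ k - m $ k) * (X \<omega> $ l - m $ l)) \<and>
            (\<integral>\<omega>. (X \<omega> $ k - m $ k) * (X \<omega> $ l - m $ l) \<partial>P) = S $ k $ l)"

text \<open>The centred normal law \<open>N(0, S)\<close> on \<open>\<real>\<^sup>k\<close>, for positive definite \<open>S\<close>.\<close>

definition mv_normal :: "real^'k^'k \<Rightarrow> (real^'k) measure" where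
  "mv_normal S = density lborel
     (\<lambda>x. ennreal (exp (- (x \<bullet> (matrix_inv S *v x)) / 2) / sqrt ((2 * pi) ^ CARD('k) * det S)))"

text \<open>
  Weak convergence of Borel laws on a general space, since \<^const>\<open>weak_conv_m\<close> covers only the
  real line.
\<close>

definition weak_conv_gen :: "(nat \<Rightarrow> 'a::topological_space measure) \<Rightarrow> 'a measure \<Rightarrow> bool" where
  "weak_conv_gen \<mu> \<nu> \<longleftrightarrow>
     (\<forall>f :: 'a \<Rightarrow> real. continuous_on UNIV f \<and> bounded (range f) \<longrightarrow>
        (\<lambda>n. \<integral>x. f x \<partial>\<mu> n) \<longlonglongrightarrow> (\<integral>x. f x \<partial>\<nu>))"

definition consistent_for :: "'w measure \<Rightarrow> (nat \<Rightarrow> 'w \<Rightarrow> 'a::metric_space) \<Rightarrow> 'a \<Rightarrow> bool" where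
  "consistent_for P X c \<longleftrightarrow>
     (\<forall>\<delta>>0. (\<lambda>n. measure P {\<omega> \<in> space P. dist (X n \<omega>) c > \<delta>}) \<longlonglongrightarrow> 0)"

end

theory Submission
  imports Defs "HOL-Computational_Algebra.Fundamental_Theorem_Algebra"
begin

text \<open>
  The statistic is asymptotically a linear form in \<open>Z\<^sub>T = \<surd>T vec (M\<^sub>T - M)\<close>, where \<open>M\<^sub>T\<close> is the
  sample mean of the data. The usual route is the delta method with the derivative of
  \<open>N \<mapsto> d\<^sub>i\<^sub>j(N)\<close> at \<open>M\<close>. Here differentiation is replaced by an exact identity: for \<open>N\<close> near \<open>M\<close>,
  \<open>d\<^sub>i\<^sub>j(N) - d\<^sub>i\<^sub>j(M) = \<beta>(N) \<bullet> vec (N - M)\<close>, where \<open>\<beta>(N)\<close> has the form of \<open>B\<^sub>i\<^sub>j\<close> with some of its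
  ingredients taken at \<open>N\<close> and the others at \<open>M\<close> (\<open>d_coef_diff_eq_slope\<close>). It comes from the
  Sylvester equation satisfied by \<open>L\<^sub>J(M)\<^sup>T R\<^sub>I(N)\<close>. The equation is uniquely solvable because the
  spectra of \<open>\<Lambda>\<^sub>I\<close> and \<open>\<Lambda>\<^sub>J\<close> are disjoint (\<open>sylvester_zero\<close>), and the map \<open>\<beta>\<close> is continuous at \<open>M\<close>
  with \<open>\<beta>(M) = B\<^sub>i\<^sub>j\<close>.

  Whenever the estimates are close to their targets, the statistic is therefore
  \<open>\<gamma>(M\<^sub>T, \<Omega>\<^sub>T) \<bullet> Z\<^sub>T\<close> with \<open>\<Omega>\<^sub>T\<close> the estimate of \<open>\<Omega>\<close> and \<open>\<gamma> = \<beta> / \<sigma>\<close>. The map \<open>\<gamma>\<close> is continuous at \<open>(M, \<Omega>)\<close> since \<open>\<sigma>\<close> is positive there: \<open>\<Omega>\<close> is positive definite and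
  \<open>B\<^sub>i\<^sub>j \<noteq> 0\<close> (\<open>B_row_nonzero\<close>). As \<open>(M\<^sub>T, \<Omega>\<^sub>T)\<close> tends to \<open>(M, \<Omega>)\<close> in probability and \<open>Z\<^sub>T\<close> converges in
  law to \<open>N(0, \<Omega>)\<close>, the statistic converges in law to \<open>c \<bullet> z\<close> with \<open>z\<close> distributed as
  \<open>N(0, \<Omega>)\<close> and \<open>c = \<gamma>(M, \<Omega>)\<close> (\<open>slutsky_inner\<close>). The vector \<open>c\<close> is normalised by
  \<open>c \<bullet> \<Omega> c = 1\<close>, and such a linear form of a normal vector is standard normal
  (\<open>distr_inner_mv_normal\<close>).
\<close>

lemma matrix_inv_right: "invertible A \<Longrightarrow> A ** matrix_inv A = mat 1"
  and matrix_inv_left: "invertible A \<Longrightarrow> matrix_inv A ** A = mat 1"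
  unfolding invertible_def matrix_inv_def by (metis (mono_tags, lifting) someI_ex)+

section \<open>Linear forms of a multivariate normal vector\<close>

text \<open>
  Translating along \<open>S c\<close> changes the exponent of the normal density only through \<open>c \<bullet> x\<close>, because
  \<open>S\<^sup>-\<^sup>1 (S c) = c\<close>. For unit \<open>c \<bullet> S c\<close> it changes exactly like the exponent of the one-dimensional
  standard normal density under a shift of \<open>c \<bullet> x\<close> by \<open>t\<close>.
\<close>

lemma quadratic_form_shift:
  fixes S :: "real^'k^'k"
  assumes "positive_definite S" and "c \<bullet> (S *v c) = 1"
  shows "(x + t *\<^sub>R (S *v c)) \<bullet> (matrix_inv S *v (x + t *\<^sub>R (S *v c)))
           = x \<bullet> (matrix_inv S *v x) + 2 * t * (c \<bullet> x) + t\<^sup>2"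
proof -
  have sym: "transpose S = S" using assms(1) by (simp add: positive_definite_def)
  have "S *v v = 0 \<Longrightarrow> v = 0" for v
    using assms(1) by (force simp: positive_definite_def)
  then have "invertible S"
    by (simp add: invertible_left_inverse matrix_left_invertible_ker)
  then have inv: "S ** matrix_inv S = mat 1" "matrix_inv S ** S = mat 1"
    by (simp_all add: matrix_inv_left matrix_inv_right)
  define y where "y = matrix_inv S *v x"
  have xy: "x = S *v y"
    using inv by (simp add: y_def matrix_vector_mul_assoc)
  have self_adj: "(S *v a) \<bullet> b = a \<bullet> (S *v b)" for a b
    using sym by (metis dot_lmul_matrix vector_transpose_matrix)
  have invS: "matrix_inv S *v (S *v v) = v" for v
    using inv by (simp add: matrix_vector_mul_assoc)
  have comb: "x + t *\<^sub>R (S *v c) = S *v (y + t *\<^sub>R c)"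
    by (simp add: xy matrix_vector_right_distrib matrix_vector_mult_scaleR)
  show ?thesis
    unfolding comb invS unfolding xy invS
    using assms(2)
    by (simp add: matrix_vector_right_distrib matrix_vector_mult_scaleR inner_add_left inner_add_right
        self_adj inner_commute[of _ c] power2_eq_square algebra_simps)
qed

text \<open>
  Let \<open>f\<close> be the density of \<open>N(0, S)\<close>, \<open>\<phi>\<close> the standard normal density and \<open>u = S c\<close>, so that
  \<open>c \<bullet> u = 1\<close>. By the shift formula, \<open>f (x + t u) \<phi> (- (c \<bullet> x)) = f x \<phi> (c \<bullet> x + t)\<close>. Inserting
  \<open>1 = \<integral> \<phi> (t - c \<bullet> x) dt\<close> into \<open>\<integral> h (c \<bullet> x) f x dx\<close>, exchanging the integrals, translating \<open>x\<close> by
  \<open>t u\<close> and exchanging back separates the variables: what is left is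
  \<open>(\<integral> f x dx) (\<integral> h t \<phi> t dt) = \<integral> h t \<phi> t dt\<close>. The normalising constant
  enters only through the total mass of \<open>f\<close>.
\<close>

lemma distr_inner_mv_normal:
  fixes S :: "real^'k^'k"
  assumes pd: "positive_definite S" and prob: "prob_space (mv_normal S)"
    and unit: "c \<bullet> (S *v c) = 1"
  shows "distr (mv_normal S) borel (\<lambda>x. c \<bullet> x) = std_normal_distribution"
proof (rule measure_eqI)
  define C where "C = sqrt ((2 * pi) ^ CARD('k) * det S)"
  define f where "f x = ennreal (exp (- (x \<bullet> (matrix_inv S *v x)) / 2) / C)" for x :: "real^'k"
  define u where "u = S *v c"
  define \<phi> where "\<phi> t = ennreal (std_normal_density t)" for t
  have f_meas [measurable]: "f \<in> borel_measurable borel"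
    unfolding f_def by (intro measurable_compose[OF _ measurable_ennreal] borel_measurable_divide
        borel_measurable_const borel_measurable_continuous_onI continuous_intros) auto
  have \<phi>_meas [measurable]: "\<phi> \<in> borel_measurable borel"
    unfolding \<phi>_def by measurable
  have normal: "mv_normal S = density lborel f"
    unfolding mv_normal_def f_def C_def by simp
  have mass: "(\<integral>\<^sup>+x. f x \<partial>lborel) = 1"
    using prob_space.emeasure_space_1[OF prob] by (simp add: normal emeasure_density)
  have \<phi>_mass: "(\<integral>\<^sup>+t. \<phi> t \<partial>lborel) = 1"
    using prob_space.emeasure_space_1[OF prob_space_normal_density[of 1 0]]
    by (simp add: \<phi>_def emeasure_density)
  have cu: "c \<bullet> u = 1" using unit by (simp add: u_def)
  have shift: "f (x + t *\<^sub>R u) * \<phi> (- (c \<bullet> x)) = f x * \<phi> (c \<bullet> x + t)" for x t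
  proof -
    let ?q = "x \<bullet> (matrix_inv S *v x)" and ?q' = "(x + t *\<^sub>R u) \<bullet> (matrix_inv S *v (x + t *\<^sub>R u))"
    have "exp (- ?q' / 2) * std_normal_density (- (c \<bullet> x)) = exp (- ?q / 2) * std_normal_density (c \<bullet> x + t)"
      unfolding u_def quadratic_form_shift[OF pd unit] std_normal_density_def
      by (simp add: exp_add[symmetric] power2_eq_square field_simps)
    then have e: "exp (- ?q' / 2) / C * std_normal_density (- (c \<bullet> x))
        = exp (- ?q / 2) / C * std_normal_density (c \<bullet> x + t)"
      by (metis times_divide_eq_left)
    show ?thesis
      unfolding f_def \<phi>_def
      by (subst (1 2) ennreal_mult''[symmetric]) (simp_all only: e normal_density_nonneg)
  qed
  fix A assume "A \<in> sets (distr (mv_normal S) borel (\<lambda>x. c \<bullet> x))"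
  then have [measurable]: "A \<in> sets borel" by simp
  define h :: "real \<Rightarrow> ennreal" where "h = indicator A"
  have h_meas [measurable]: "h \<in> borel_measurable borel" unfolding h_def by measurable
  have trans1: "(\<integral>\<^sup>+x. g x \<partial>lborel) = (\<integral>\<^sup>+x. g (x + a) \<partial>lborel)"
    if [measurable]: "g \<in> borel_measurable borel" for g :: "'a::euclidean_space \<Rightarrow> ennreal" and a
    by (subst lborel_distr_plus[of a, symmetric], subst nn_integral_distr) (simp_all add: add.commute)
  have "emeasure (distr (mv_normal S) borel (\<lambda>x. c \<bullet> x)) A = (\<integral>\<^sup>+x. f x * h (c \<bullet> x) \<partial>lborel)"
    using measurable_sets_borel[of "\<lambda>x. c \<bullet> x" borel A] unfolding normal
    by (subst emeasure_distr, simp, simp, subst emeasure_density)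
      (auto simp: h_def indicator_def intro!: nn_integral_cong)
  also have "\<dots> = (\<integral>\<^sup>+x. (\<integral>\<^sup>+t. f x * h (c \<bullet> x) * \<phi> (t - c \<bullet> x) \<partial>lborel) \<partial>lborel)"
  proof (rule nn_integral_cong)
    fix x
    have "(\<integral>\<^sup>+t. \<phi> (t - c \<bullet> x) \<partial>lborel) = 1"
      using trans1[of \<phi> "- (c \<bullet> x)"] \<phi>_mass by simp
    then show "f x * h (c \<bullet> x) = (\<integral>\<^sup>+t. f x * h (c \<bullet> x) * \<phi> (t - c \<bullet> x) \<partial>lborel)"
      by (simp add: nn_integral_cmult)
  qed
  also have "\<dots> = (\<integral>\<^sup>+t. (\<integral>\<^sup>+x. f x * h (c \<bullet> x) * \<phi> (t - c \<bullet> x) \<partial>lborel) \<partial>lborel)"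
    by (rule pair_sigma_finite.Fubini'[symmetric])
      (simp_all add: pair_sigma_finite_def sigma_finite_lborel)
  also have "\<dots> = (\<integral>\<^sup>+t. (\<integral>\<^sup>+x. f x * (h (c \<bullet> x + t) * \<phi> (c \<bullet> x + t)) \<partial>lborel) \<partial>lborel)"
  proof (rule nn_integral_cong)
    fix t
    have "(\<integral>\<^sup>+x. f x * h (c \<bullet> x) * \<phi> (t - c \<bullet> x) \<partial>lborel)
        = (\<integral>\<^sup>+x. f (x + t *\<^sub>R u) * h (c \<bullet> x + t) * \<phi> (- (c \<bullet> x)) \<partial>lborel)"
      by (subst trans1[of _ "t *\<^sub>R u"]) (simp_all add: inner_add_right cu)
    also have "\<dots> = (\<integral>\<^sup>+x. f x * (h (c \<bullet> x + t) * \<phi> (c \<bullet> x + t)) \<partial>lborel)"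
      using shift by (intro nn_integral_cong) (metis mult.assoc mult.commute)
    finally show "(\<integral>\<^sup>+x. f x * h (c \<bullet> x) * \<phi> (t - c \<bullet> x) \<partial>lborel)
        = (\<integral>\<^sup>+x. f x * (h (c \<bullet> x + t) * \<phi> (c \<bullet> x + t)) \<partial>lborel)" .
  qed
  also have "\<dots> = (\<integral>\<^sup>+x. (\<integral>\<^sup>+t. f x * (h (c \<bullet> x + t) * \<phi> (c \<bullet> x + t)) \<partial>lborel) \<partial>lborel)"
    by (rule pair_sigma_finite.Fubini')
      (simp_all add: pair_sigma_finite_def sigma_finite_lborel)
  also have "\<dots> = (\<integral>\<^sup>+x. f x * (\<integral>\<^sup>+t. h t * \<phi> t \<partial>lborel) \<partial>lborel)"
  proof (rule nn_integral_cong)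
    fix x
    show "(\<integral>\<^sup>+t. f x * (h (c \<bullet> x + t) * \<phi> (c \<bullet> x + t)) \<partial>lborel) = f x * (\<integral>\<^sup>+t. h t * \<phi> t \<partial>lborel)"
      by (subst trans1[of "\<lambda>t. h t * \<phi> t" "c \<bullet> x"]) (simp_all add: nn_integral_cmult add.commute)
  qed
  also have "\<dots> = (\<integral>\<^sup>+t. h t * \<phi> t \<partial>lborel)"
    by (simp add: nn_integral_multc mass)
  also have "\<dots> = emeasure std_normal_distribution A"
    by (subst emeasure_density) (auto simp: h_def \<phi>_def mult.commute intro!: nn_integral_cong)
  finally show "emeasure (distr (mv_normal S) borel (\<lambda>x. c \<bullet> x)) A = emeasure std_normal_distribution A" .
qed simp

section \<open>Slutsky-type limit theorems\<close>

text \<open>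
  Test the convergence with the constant function 1. If \<open>\<nu>\<close> had infinite mass, the limit
  \<open>\<integral> 1 d\<nu>\<close> would be 0 by convention, which is not the limit of 1.
\<close>

lemma weak_conv_gen_total_mass:
  fixes \<nu> :: "'a::euclidean_space measure"
  assumes "weak_conv_gen \<mu> \<nu>" and "\<And>n. prob_space (\<mu> n)"
  shows "prob_space \<nu>"
proof (rule prob_spaceI)
  have "(\<lambda>n. \<integral>x. (1::real) \<partial>\<mu> n) \<longlonglongrightarrow> (\<integral>x. 1 \<partial>\<nu>)"
    using assms(1)[unfolded weak_conv_gen_def, rule_format, of "\<lambda>_. 1"] by simp
  then have "(\<lambda>n. 1::real) \<longlonglongrightarrow> measure \<nu> (space \<nu>)"
    using assms(2) by (simp add: prob_space.prob_space)
  then have "measure \<nu> (space \<nu>) = 1"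
    using LIMSEQ_unique tendsto_const by blast
  then show "emeasure \<nu> (space \<nu>) = 1"
    by (metis emeasure_eq_ennreal_measure ennreal_1 measure_zero_top zero_neq_one)
qed

text \<open>
  A ball of large radius \<open>k\<close> has almost full \<open>\<nu>\<close>-mass. The continuous ramp that rises from 0 to 1 as
  the norm goes from \<open>k\<close> to \<open>k + 1\<close> lies between the indicators of \<open>norm z > k + 1\<close> and of
  \<open>norm z > k\<close>, and so carries this bound over to the laws of \<open>Z n\<close> for large \<open>n\<close>.
\<close>

lemma weak_conv_gen_tight:
  fixes Z :: "nat \<Rightarrow> 'w \<Rightarrow> 'a::euclidean_space"
  assumes P: "prob_space P" and [measurable]: "\<And>n. Z n \<in> borel_measurable P"
    and conv: "weak_conv_gen (\<lambda>n. distr P borel (Z n)) \<nu>"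
    and \<nu>: "prob_space \<nu>" and sets_\<nu> [measurable_cong]: "sets \<nu> = sets borel" and "e > 0"
  obtains K where "K > 0" "\<forall>\<^sub>F n in sequentially. measure P {\<omega> \<in> space P. norm (Z n \<omega>) > K} < e"
proof -
  interpret P: prob_space P by fact
  interpret \<nu>: prob_space \<nu> by fact
  have "(\<lambda>k. measure \<nu> {z \<in> space \<nu>. norm z > real k}) \<longlonglongrightarrow> measure \<nu> (\<Inter>k. {z \<in> space \<nu>. norm z > real k})"
    by (rule \<nu>.finite_Lim_measure_decseq) (auto simp: decseq_def)
  moreover have "(\<Inter>k. {z \<in> space \<nu>. norm z > real k}) = {}"
    using reals_Archimedean2 by (auto dest: less_asym)
  ultimately have "\<forall>\<^sub>F k in sequentially. measure \<nu> {z \<in> space \<nu>. norm z > real k} < e"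
    using \<open>e > 0\<close> by (auto intro: order_tendstoD)
  then obtain k where k: "measure \<nu> {z \<in> space \<nu>. norm z > real k} < e"
    by (auto simp: eventually_sequentially)
  define f :: "'a \<Rightarrow> real" where "f z = min 1 (max 0 (norm z - real k))" for z
  have f_bounds: "0 \<le> f z" "f z \<le> 1" for z by (auto simp: f_def)
  have f_cont: "continuous_on UNIV f" unfolding f_def by (intro continuous_intros)
  have [measurable]: "f \<in> borel_measurable borel" by (rule borel_measurable_continuous_onI[OF f_cont])
  have "bounded (range f)" unfolding bounded_iff using f_bounds by (auto intro!: exI[of _ 1])
  then have "(\<lambda>n. \<integral>z. f z \<partial>distr P borel (Z n)) \<longlonglongrightarrow> (\<integral>z. f z \<partial>\<nu>)"
    using conv f_cont by (auto simp: weak_conv_gen_def)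
  moreover have "(\<integral>z. f z \<partial>\<nu>) \<le> (\<integral>z. indicator {z \<in> space \<nu>. norm z > real k} z \<partial>\<nu>)"
    by (intro integral_mono \<nu>.integrable_const_bound[of _ 1])
      (auto simp: f_def indicator_def)
  ultimately have "\<forall>\<^sub>F n in sequentially. (\<integral>z. f z \<partial>distr P borel (Z n)) < e"
    using k by (auto intro: order_tendstoD)
  moreover have "measure P {\<omega> \<in> space P. norm (Z n \<omega>) > real k + 1} \<le> (\<integral>z. f z \<partial>distr P borel (Z n))" for n
  proof -
    have "measure P {\<omega> \<in> space P. norm (Z n \<omega>) > real k + 1}
        = (\<integral>\<omega>. indicator {\<omega> \<in> space P. norm (Z n \<omega>) > real k + 1} \<omega> \<partial>P)"
      by simp
    also have "\<dots> \<le> (\<integral>\<omega>. f (Z n \<omega>) \<partial>P)"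
      by (intro integral_mono P.integrable_const_bound[of _ 1])
        (auto simp: f_def indicator_def)
    finally show ?thesis by (subst integral_distr) simp_all
  qed
  ultimately have "\<forall>\<^sub>F n in sequentially. measure P {\<omega> \<in> space P. norm (Z n \<omega>) > real k + 1} < e"
    by (auto elim!: eventually_mono intro: le_less_trans)
  then show thesis by (intro that[of "real k + 1"]) auto
qed

text \<open>
  On the event that \<open>Z n\<close> is bounded by \<open>K\<close> and \<open>X n\<close> is close to \<open>x0\<close>, the difference of \<open>W n\<close> and
  \<open>\<gamma> x0 \<bullet> Z n\<close> is at most \<open>K\<close> times the small norm of \<open>\<gamma> (X n) - \<gamma> x0\<close>. By tightness and
  consistency this event has probability close to 1, so bounded uniformly continuous functions of
  the two variables have the same limiting expectation. The identity between \<open>W n\<close> and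
  \<open>\<gamma> (X n) \<bullet> Z n\<close> is asked for only near \<open>x0\<close>, so that it may come from a locally valid formula.
\<close>

lemma slutsky_inner:
  fixes Z :: "nat \<Rightarrow> 'w \<Rightarrow> 'a::euclidean_space"
    and X :: "nat \<Rightarrow> 'w \<Rightarrow> 'b::{second_countable_topology, metric_space}"
  assumes P: "prob_space P" and Z [measurable]: "\<And>n. Z n \<in> borel_measurable P"
    and conv: "weak_conv_gen (\<lambda>n. distr P borel (Z n)) \<nu>"
    and \<nu>: "prob_space \<nu>" and sets_\<nu> [measurable_cong]: "sets \<nu> = sets borel"
    and X [measurable]: "\<And>n. X n \<in> borel_measurable P" and cons: "consistent_for P X x0"
    and cont: "isCont \<gamma> x0" and W [measurable]: "\<And>n. W n \<in> borel_measurable P"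
    and ev: "\<forall>\<^sub>F x in nhds x0. \<forall>n. \<forall>\<omega>\<in>space P. X n \<omega> = x \<longrightarrow> W n \<omega> = \<gamma> x \<bullet> Z n \<omega>"
  shows "weak_conv_m (\<lambda>n. distr P borel (W n)) (distr \<nu> borel (\<lambda>z. \<gamma> x0 \<bullet> z))"
proof (rule integral_cts_step_conv_imp_weak_conv)
  interpret P: prob_space P by fact
  interpret \<nu>: prob_space \<nu> by fact
  let ?c = "\<gamma> x0"
  show "real_distribution (distr P borel (W n))" for n
    by (intro P.real_distribution_distr) simp
  show "real_distribution (distr \<nu> borel (\<lambda>z. ?c \<bullet> z))"
    by (intro \<nu>.real_distribution_distr) simp
  fix a b :: real assume "a < b"
  define h where "h = cts_step a b"
  have uc: "uniformly_continuous_on UNIV h"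
    unfolding h_def by (rule cts_step_uniformly_continuous[OF \<open>a < b\<close>])
  have h_cont: "continuous_on UNIV h" by (rule uniformly_continuous_imp_continuous[OF uc])
  have h_bounds: "0 \<le> h x" "h x \<le> 1" for x
    using \<open>a < b\<close> by (auto simp: h_def cts_step_def field_simps)
  have h_meas [measurable]: "h \<in> borel_measurable borel"
    by (rule borel_measurable_continuous_onI[OF h_cont])
  have lim: "(\<lambda>n. \<integral>\<omega>. h (?c \<bullet> Z n \<omega>) \<partial>P) \<longlonglongrightarrow> (\<integral>z. h (?c \<bullet> z) \<partial>\<nu>)"
  proof -
    have "continuous_on UNIV (\<lambda>z. h (?c \<bullet> z))"
      by (intro continuous_on_compose2[OF h_cont]) (auto intro!: continuous_intros)
    moreover have "bounded (range (\<lambda>z. h (?c \<bullet> z)))"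
      unfolding bounded_iff using h_bounds by (auto intro!: exI[of _ 1])
    ultimately have "(\<lambda>n. \<integral>z. h (?c \<bullet> z) \<partial>distr P borel (Z n)) \<longlonglongrightarrow> (\<integral>z. h (?c \<bullet> z) \<partial>\<nu>)"
      using conv by (auto simp: weak_conv_gen_def)
    then show ?thesis by (subst (asm) integral_distr) simp_all
  qed
  have diff: "(\<lambda>n. (\<integral>\<omega>. h (W n \<omega>) \<partial>P) - (\<integral>\<omega>. h (?c \<bullet> Z n \<omega>) \<partial>P)) \<longlonglongrightarrow> 0"
  proof (rule LIMSEQ_I)
    fix e0 :: real assume "e0 > 0"
    define e where "e = e0 / 4"
    have "e > 0" using \<open>e0 > 0\<close> by (simp add: e_def)
    obtain d where d: "d > 0" "\<And>x y. dist x y < d \<Longrightarrow> dist (h x) (h y) < e"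
      using uc \<open>e > 0\<close> by (auto simp: uniformly_continuous_on_def)
    obtain K where K: "K > 0"
      and evK: "\<forall>\<^sub>F n in sequentially. measure P {\<omega> \<in> space P. norm (Z n \<omega>) > K} < e"
      using weak_conv_gen_tight[OF P Z conv \<nu> sets_\<nu> \<open>e > 0\<close>] by blast
    have "\<forall>\<^sub>F x in nhds x0. dist (\<gamma> x) ?c < d / K"
      using cont d(1) K by (intro tendstoD) (auto simp: isCont_def tendsto_at_iff_tendsto_nhds)
    with ev have "\<forall>\<^sub>F x in nhds x0. dist (\<gamma> x) ?c < d / K \<and>
        (\<forall>n. \<forall>\<omega>\<in>space P. X n \<omega> = x \<longrightarrow> W n \<omega> = \<gamma> x \<bullet> Z n \<omega>)"
      by eventually_elim auto
    then obtain \<delta>0 where \<delta>0: "\<delta>0 > 0" "\<And>x. dist x x0 < \<delta>0 \<Longrightarrow> dist (\<gamma> x) ?c < d / K \<and>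
        (\<forall>n. \<forall>\<omega>\<in>space P. X n \<omega> = x \<longrightarrow> W n \<omega> = \<gamma> x \<bullet> Z n \<omega>)"
      unfolding eventually_nhds_metric by blast
    define \<delta> where "\<delta> = \<delta>0 / 2"
    have \<delta>: "\<delta> > 0" "\<delta> < \<delta>0" using \<delta>0(1) by (auto simp: \<delta>_def)
    have "\<forall>\<^sub>F n in sequentially. measure P {\<omega> \<in> space P. dist (X n \<omega>) x0 > \<delta>} < e"
      using cons \<delta>(1) \<open>e > 0\<close> by (auto simp: consistent_for_def intro: order_tendstoD)
    with evK have "\<forall>\<^sub>F n in sequentially.
        norm ((\<integral>\<omega>. h (W n \<omega>) \<partial>P) - (\<integral>\<omega>. h (?c \<bullet> Z n \<omega>) \<partial>P)) < e0"
    proof eventually_elim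
      case (elim n)
      let ?E = "{\<omega> \<in> space P. norm (Z n \<omega>) > K}" and ?F = "{\<omega> \<in> space P. dist (X n \<omega>) x0 > \<delta>}"
      have ptw: "norm (h (W n \<omega>) - h (?c \<bullet> Z n \<omega>)) \<le> e + indicator ?E \<omega> + indicator ?F \<omega>"
        if "\<omega> \<in> space P" for \<omega>
      proof (cases "\<omega> \<in> ?E \<or> \<omega> \<in> ?F")
        case True
        have "norm (h (W n \<omega>) - h (?c \<bullet> Z n \<omega>)) \<le> 1"
          using h_bounds[of "W n \<omega>"] h_bounds[of "?c \<bullet> Z n \<omega>"] by (auto simp: abs_le_iff)
        then show ?thesis using True \<open>e > 0\<close> by (auto simp: indicator_def)
      next
        case False
        then have nZ: "norm (Z n \<omega>) \<le> K" and dX: "dist (X n \<omega>) x0 < \<delta>0" using that \<delta>(2) by auto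
        have Weq: "W n \<omega> = \<gamma> (X n \<omega>) \<bullet> Z n \<omega>" and dg: "dist (\<gamma> (X n \<omega>)) ?c < d / K"
          using \<delta>0(2)[OF dX] that by auto
        have "dist (W n \<omega>) (?c \<bullet> Z n \<omega>) = \<bar>(\<gamma> (X n \<omega>) - ?c) \<bullet> Z n \<omega>\<bar>"
          by (simp add: Weq dist_real_def inner_diff_left)
        also have "\<dots> \<le> norm (\<gamma> (X n \<omega>) - ?c) * norm (Z n \<omega>)"
          by (rule Cauchy_Schwarz_ineq2)
        also have "\<dots> \<le> norm (\<gamma> (X n \<omega>) - ?c) * K"
          by (intro mult_left_mono nZ) simp
        also have "\<dots> < d"
          using dg K by (simp add: dist_norm field_simps)
        finally show ?thesis using d(2)[of "W n \<omega>" "?c \<bullet> Z n \<omega>"] False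
          by (simp add: dist_real_def less_imp_le)
      qed
      have int: "integrable P (\<lambda>\<omega>. h (W n \<omega>))" "integrable P (\<lambda>\<omega>. h (?c \<bullet> Z n \<omega>))"
        using h_bounds by (auto intro!: P.integrable_const_bound[of _ 1])
      have intEF: "integrable P (indicator ?E :: _ \<Rightarrow> real)" "integrable P (indicator ?F :: _ \<Rightarrow> real)"
        by (auto intro!: P.integrable_const_bound[of _ 1])
      have "norm ((\<integral>\<omega>. h (W n \<omega>) \<partial>P) - (\<integral>\<omega>. h (?c \<bullet> Z n \<omega>) \<partial>P))
          = norm (\<integral>\<omega>. h (W n \<omega>) - h (?c \<bullet> Z n \<omega>) \<partial>P)"
        using int by simp
      also have "\<dots> \<le> (\<integral>\<omega>. norm (h (W n \<omega>) - h (?c \<bullet> Z n \<omega>)) \<partial>P)"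
        by (rule integral_norm_bound)
      also have "\<dots> \<le> (\<integral>\<omega>. e + indicator ?E \<omega> + indicator ?F \<omega> \<partial>P)"
        by (rule integral_mono) (use int intEF ptw in auto)
      also have "\<dots> = e + measure P ?E + measure P ?F"
        using intEF by (simp add: P.prob_space)
      also have "\<dots> < e0" using elim \<open>e0 > 0\<close> by (simp add: e_def)
      finally show ?case .
    qed
    then show "\<exists>no. \<forall>n\<ge>no. norm ((\<integral>\<omega>. h (W n \<omega>) \<partial>P) - (\<integral>\<omega>. h (?c \<bullet> Z n \<omega>) \<partial>P) - 0) < e0"
      by (simp add: eventually_sequentially)
  qed
  have "(\<lambda>n. \<integral>\<omega>. h (W n \<omega>) \<partial>P) \<longlonglongrightarrow> (\<integral>z. h (?c \<bullet> z) \<partial>\<nu>)"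
    using tendsto_add[OF diff lim] by simp
  then show "(\<lambda>n. integral\<^sup>L (distr P borel (W n)) (cts_step a b))
      \<longlonglongrightarrow> integral\<^sup>L (distr \<nu> borel (\<lambda>z. ?c \<bullet> z)) (cts_step a b)"
    by (subst (1 2) integral_distr) (simp_all add: h_def[symmetric])
qed

text \<open>
  A sequence that remains tight after multiplication by \<open>sqrt n\<close> must tend to 0: deviations larger
  than \<open>\<delta>\<close> force \<open>norm (Z n) > K\<close> as soon as \<open>sqrt n > K / \<delta>\<close>.
\<close>

lemma consistent_for_scaled_tight:
  fixes X :: "nat \<Rightarrow> 'w \<Rightarrow> 'a::real_normed_vector" and Z :: "nat \<Rightarrow> 'w \<Rightarrow> 'b::euclidean_space"
  assumes P: "prob_space P" and Z [measurable]: "\<And>n. Z n \<in> borel_measurable P"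
    and conv: "weak_conv_gen (\<lambda>n. distr P borel (Z n)) \<nu>"
    and \<nu>: "prob_space \<nu>" "sets \<nu> = sets borel"
    and scale: "\<And>n \<omega>. norm (Z n \<omega>) = sqrt (real n) * dist (X n \<omega>) x"
  shows "consistent_for P X x"
  unfolding consistent_for_def
proof (intro allI impI)
  interpret P: prob_space P by fact
  fix \<delta> :: real assume "\<delta> > 0"
  show "(\<lambda>n. measure P {\<omega> \<in> space P. dist (X n \<omega>) x > \<delta>}) \<longlonglongrightarrow> 0"
  proof (rule order_tendstoI)
    fix e :: real assume "e > 0"
    obtain K where "K > 0"
      and evK: "\<forall>\<^sub>F n in sequentially. measure P {\<omega> \<in> space P. norm (Z n \<omega>) > K} < e"
      using weak_conv_gen_tight[OF P Z conv \<nu> \<open>e > 0\<close>] by blast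
    have "filterlim (\<lambda>n. sqrt (real n)) at_top sequentially"
      by (intro filterlim_compose[OF sqrt_at_top] filterlim_real_sequentially)
    then have "\<forall>\<^sub>F n in sequentially. K / \<delta> < sqrt (real n)"
      by (simp add: filterlim_at_top_dense)
    with evK show "\<forall>\<^sub>F n in sequentially. measure P {\<omega> \<in> space P. dist (X n \<omega>) x > \<delta>} < e"
    proof eventually_elim
      case (elim n)
      have "K < norm (Z n \<omega>)" if "\<delta> < dist (X n \<omega>) x" for \<omega>
      proof -
        have "K < sqrt (real n) * \<delta>" using elim(2) \<open>\<delta> > 0\<close> by (simp add: field_simps)
        also have "\<dots> \<le> sqrt (real n) * dist (X n \<omega>) x" using that by (intro mult_left_mono) auto
        finally show ?thesis by (simp add: scale)
      qed
      then have "{\<omega> \<in> space P. dist (X n \<omega>) x > \<delta>} \<subseteq> {\<omega> \<in> space P. norm (Z n \<omega>) > K}" by auto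
      then have "measure P {\<omega> \<in> space P. dist (X n \<omega>) x > \<delta>} \<le> measure P {\<omega> \<in> space P. norm (Z n \<omega>) > K}"
        by (intro P.finite_measure_mono) auto
      then show ?case using elim(1) by simp
    qed
  next
    fix e :: real assume "e < 0"
    then show "\<forall>\<^sub>F n in sequentially. e < measure P {\<omega> \<in> space P. dist (X n \<omega>) x > \<delta>}"
      by (intro always_eventually allI) (auto intro: less_le_trans)
  qed
qed

lemma consistent_for_Pair:
  fixes X :: "nat \<Rightarrow> 'w \<Rightarrow> 'a::{second_countable_topology, metric_space}"
    and Y :: "nat \<Rightarrow> 'w \<Rightarrow> 'b::{second_countable_topology, metric_space}"
  assumes P: "prob_space P"
    and [measurable]: "\<And>n. X n \<in> borel_measurable P" "\<And>n. Y n \<in> borel_measurable P"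
    and X: "consistent_for P X x" and Y: "consistent_for P Y y"
  shows "consistent_for P (\<lambda>n \<omega>. (X n \<omega>, Y n \<omega>)) (x, y)"
  unfolding consistent_for_def
proof (intro allI impI)
  interpret P: prob_space P by fact
  fix \<delta> :: real assume "\<delta> > 0"
  let ?E = "\<lambda>n. {\<omega> \<in> space P. dist (X n \<omega>) x > \<delta> / 2}" and ?F = "\<lambda>n. {\<omega> \<in> space P. dist (Y n \<omega>) y > \<delta> / 2}"
  have "(\<lambda>n. measure P (?E n) + measure P (?F n)) \<longlonglongrightarrow> 0 + 0"
    using X Y half_gt_zero[OF \<open>\<delta> > 0\<close>] unfolding consistent_for_def by (intro tendsto_add) blast+
  then have lim: "(\<lambda>n. measure P (?E n) + measure P (?F n)) \<longlonglongrightarrow> 0" by simp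
  show "(\<lambda>n. measure P {\<omega> \<in> space P. dist (X n \<omega>, Y n \<omega>) (x, y) > \<delta>}) \<longlonglongrightarrow> 0"
  proof (rule tendsto_sandwich[OF _ _ tendsto_const lim])
    have "measure P {\<omega> \<in> space P. dist (X n \<omega>, Y n \<omega>) (x, y) > \<delta>} \<le> measure P (?E n) + measure P (?F n)" for n
    proof -
      have "\<delta> / 2 < dist a x \<or> \<delta> / 2 < dist b y" if "\<delta> < dist (a, b) (x, y)" for a b
        using that sqrt_sum_squares_le_sum_abs[of "dist a x" "dist b y"] by (auto simp: dist_Pair_Pair)
      then have "{\<omega> \<in> space P. dist (X n \<omega>, Y n \<omega>) (x, y) > \<delta>} \<subseteq> ?E n \<union> ?F n" by auto
      then have "measure P {\<omega> \<in> space P. dist (X n \<omega>, Y n \<omega>) (x, y) > \<delta>} \<le> measure P (?E n \<union> ?F n)"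
        by (intro P.finite_measure_mono) auto
      also have "\<dots> \<le> measure P (?E n) + measure P (?F n)"
        by (intro measure_Un_le) auto
      finally show ?thesis .
    qed
    then show "\<forall>\<^sub>F n in sequentially. measure P {\<omega> \<in> space P. dist (X n \<omega>, Y n \<omega>) (x, y) > \<delta>}
        \<le> measure P (?E n) + measure P (?F n)" by simp
  qed simp
qed

section \<open>Sylvester equations with disjoint spectra\<close>

text \<open>
  The vector \<open>p(A) v\<close>, evaluated by Horner's rule so that it unfolds along \<^const>\<open>pCons\<close>.
\<close>

definition poly_act :: "complex^'n^'n \<Rightarrow> complex poly \<Rightarrow> complex^'n \<Rightarrow> complex^'n" where
  "poly_act A p v = fold_coeffs (\<lambda>a w. a *s v + A *v w) p 0"

lemma poly_act_0 [simp]: "poly_act A 0 v = 0"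
  by (simp add: poly_act_def)

lemma poly_act_pCons [simp]: "poly_act A (pCons a p) v = a *s v + A *v poly_act A p v"
proof (cases "p = 0 \<and> a = 0")
  case True
  then show ?thesis by (simp add: matrix_vector_mult_def vec_eq_iff)
next
  case False
  then show ?thesis unfolding poly_act_def by (cases "p = 0") simp_all
qed

lemma poly_act_add: "poly_act A (p + q) v = poly_act A p v + poly_act A q v"
proof (induction p q rule: poly_induct2)
  case (pCons a p b q)
  then show ?case by (simp add: matrix_vector_right_distrib vector_sadd_rdistrib algebra_simps)
qed simp

lemma poly_act_smult: "poly_act A (smult c p) v = c *s poly_act A p v"
  by (induction p)
    (simp_all add: vector_add_ldistrib vector_smult_assoc matrix_vector_mult_def vec_eq_iff
      sum_distrib_left algebra_simps)

lemma poly_act_linear_factor: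
  "poly_act A ([:- z, 1:] * q) v = A *v poly_act A q v - z *s poly_act A q v"
  "poly_act A ([:- z, 1:] * q) v = poly_act A q (A *v v - z *s v)"
proof -
  show *: "poly_act A ([:- z, 1:] * q) v = A *v poly_act A q v - z *s poly_act A q v"
    using poly_act_add[of A "pCons 0 q" "smult (- z) q" v] poly_act_smult[of A "- z" q v]
    by (simp add: vec_eq_iff matrix_vector_mult_def)
  have "poly_act A q (A *v v - z *s v) = A *v poly_act A q v - z *s poly_act A q v"
  proof (induction q)
    case (pCons a q)
    show ?case
      unfolding poly_act_pCons pCons.IH
      by (simp add: matrix_vector_right_distrib matrix_vector_mult_diff_distrib vector_scalar_commute
          vec_eq_iff algebra_simps)
  qed simp
  with * show "poly_act A ([:- z, 1:] * q) v = poly_act A q (A *v v - z *s v)" by simp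
qed

lemma poly_act_monom: "poly_act A (monom c k) v = c *s (((*v) A) ^^ k) v"
  by (induction k) (simp_all add: monom_0 monom_Suc vector_scalar_commute)

lemma poly_act_sum: "poly_act A (\<Sum>k\<in>I. p k) v = (\<Sum>k\<in>I. poly_act A (p k) v)"
  by (induction I rule: infinite_finite_induct) (simp_all add: poly_act_add)

text \<open>
  The \<open>n + 1\<close> vectors \<open>v, A v, \<dots>, A\<^sup>n v\<close> of an \<open>n\<close>-dimensional space are linearly dependent, and a
  dependence between them is a polynomial. A coincidence of two of the vectors is treated apart,
  since as a set they may then be independent.
\<close>

lemma ex_annihilating_poly:
  fixes A :: "complex^'n^'n"
  obtains p where "p \<noteq> 0" "poly_act A p v = 0"
proof -
  define x where "x k = (((*v) A) ^^ k) v" for k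
  show thesis
  proof (cases "inj_on x {..CARD('n)}")
    case True
    have "vec.dependent (x ` {..CARD('n)})"
    proof (rule ccontr)
      assume "\<not> ?thesis"
      then have "card (x ` {..CARD('n)}) \<le> CARD('n)"
        using vec.independent_card_le_dim[of "x ` {..CARD('n)}" UNIV] by (simp add: vec.dim_UNIV card_image True card_cart_basis)
      then show False using True by (simp add: card_image)
    qed
    then obtain u k where u: "(\<Sum>w\<in>x ` {..CARD('n)}. u w *s w) = 0" and k: "k \<le> CARD('n)" "u (x k) \<noteq> 0"
      by (auto simp: vec.dependent_finite)
    define p where "p = (\<Sum>k\<le>CARD('n). monom (u (x k)) k)"
    have "coeff p k = u (x k)"
      using k by (simp add: p_def coeff_sum)
    then have "p \<noteq> 0" using k by auto
    moreover have "poly_act A p v = 0"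
      using u True by (simp add: p_def poly_act_sum poly_act_monom sum.reindex flip: x_def)
    ultimately show thesis by (rule that)
  next
    case False
    then obtain k l where kl: "k \<noteq> l" "x k = x l" by (auto simp: inj_on_def)
    define p where "p = monom (1::complex) k + monom (-1) l"
    have "coeff p k = 1" using kl by (simp add: p_def)
    then have "p \<noteq> 0" by auto
    moreover have "poly_act A p v = 0"
      using kl by (simp add: p_def poly_act_add poly_act_monom vec_eq_iff flip: x_def)
    ultimately show thesis by (rule that)
  qed
qed

text \<open>
  Split off a root: \<open>p = (X - z) q\<close>. Either \<open>q(A) v = 0\<close>, and \<open>q\<close> has smaller degree, or \<open>q(A) v\<close> is
  an eigenvector of \<open>A\<close>, so that \<open>z\<close> is not an eigenvalue of \<open>B\<close>. In the latter case \<open>q\<close> annihilates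
  \<open>(A - z) v\<close>, hence \<open>(B - z) Y v = Y (A - z) v = 0\<close> by induction, and \<open>Y v = 0\<close>.
\<close>

lemma intertwiner_kills_annihilated:
  fixes A :: "complex^'n^'n" and B :: "complex^'m^'m" and Y :: "complex^'n^'m"
  assumes YA: "Y ** A = B ** Y"
    and disj: "\<And>z v w. A *v v = z *s v \<Longrightarrow> B *v w = z *s w \<Longrightarrow> v = 0 \<or> w = 0"
    and "p \<noteq> 0" "poly_act A p v = 0"
  shows "Y *v v = 0"
  using assms(3,4)
proof (induction "degree p" arbitrary: p v)
  case 0
  then obtain c where "p = [:c:]" "c \<noteq> 0" by (metis degree_0_id pCons_0_0)
  with 0 show ?case by (simp add: vec.scale_eq_0_iff)
next
  case (Suc n)
  then have "\<not> constant (poly p)" by (simp add: constant_degree)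
  then obtain z where "poly p z = 0" using fundamental_theorem_of_algebra by blast
  then obtain q where q: "p = [:- z, 1:] * q"
    unfolding poly_eq_0_iff_dvd by (rule dvdE)
  have "q \<noteq> 0" using Suc.prems q by auto
  then have dq: "n = degree q" using Suc.hyps(2) unfolding q by (subst (asm) degree_mult_eq) auto
  define w where "w = poly_act A q v"
  have w: "A *v w = z *s w"
    using Suc.prems(2) unfolding q w_def poly_act_linear_factor(1) by simp
  show ?case
  proof (cases "w = 0")
    case True
    then show ?thesis using Suc.hyps(1)[OF dq \<open>q \<noteq> 0\<close>] by (simp add: w_def)
  next
    case False
    have "Y *v (A *v v - z *s v) = 0"
      using Suc.prems(2) unfolding q poly_act_linear_factor(2) by (intro Suc.hyps(1)[OF dq \<open>q \<noteq> 0\<close>])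
    moreover have "Y *v (A *v v) = B *v (Y *v v)"
      by (simp add: matrix_vector_mul_assoc YA)
    ultimately have "B *v (Y *v v) = z *s (Y *v v)"
      by (simp add: matrix_vector_mult_diff_distrib vector_scalar_commute)
    with disj[OF w] False show ?thesis by blast
  qed
qed

lemma map_matrix_of_real_mult:
  "map_matrix complex_of_real (A ** B) = map_matrix complex_of_real A ** map_matrix complex_of_real B"
  by (simp add: vec_eq_iff matrix_matrix_mult_def)

text \<open>
  Uniqueness in Sylvester's theorem: after complexification every vector has an annihilating
  polynomial, and so is killed by \<open>Y\<close>.
\<close>

lemma sylvester_zero:
  fixes A :: "real^'n^'n" and B :: "real^'m^'m" and Y :: "real^'n^'m"
  assumes disj: "eigvals A \<inter> eigvals B = {}" and YA: "Y ** A = B ** Y"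
  shows "Y = 0"
proof -
  let ?c = "map_matrix complex_of_real"
  have "?c Y *v v = 0" for v
  proof -
    obtain p where "p \<noteq> 0" "poly_act (?c A) p v = 0" by (rule ex_annihilating_poly)
    moreover have "?c Y ** ?c A = ?c B ** ?c Y" by (metis YA map_matrix_of_real_mult)
    moreover have "v = 0 \<or> w = 0" if "?c A *v v = z *s v" "?c B *v w = z *s w" for z v w
      using disj that by (auto simp: eigvals_def)
    ultimately show ?thesis by (intro intertwiner_kills_annihilated)
  qed
  then have "?c Y = 0" by (metis matrix_eq matrix_vector_mult_0)
  then show ?thesis by (simp add: vec_eq_iff)
qed

section \<open>Column stacking and Kronecker products\<close>

lemma vec_of_inner: "vec_of A \<bullet> vec_of B = A \<bullet> B" for A B :: "real^'n^'m"
proof -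
  have "vec_of A \<bullet> vec_of B = (\<Sum>j\<in>UNIV. \<Sum>i\<in>UNIV. A $ i $ j * B $ i $ j)"
    by (simp add: inner_vec_def vec_of_def sum.cartesian_product case_prod_unfold)
  also have "\<dots> = A \<bullet> B" by (subst sum.swap) (simp add: inner_vec_def)
  finally show ?thesis .
qed

lemma norm_vec_of: "norm (vec_of A) = norm A" for A :: "real^'n^'m"
  by (simp add: norm_eq_sqrt_inner vec_of_inner)

lemma surj_vec_of: "surj vec_of"
  by (rule surjI[of _ "\<lambda>v. \<chi> i j. v $ (j, i)"]) (simp add: vec_of_def vec_eq_iff)

lemma vec_of_diff: "vec_of (A - B) = vec_of A - vec_of B"
  by (simp add: vec_of_def vec_eq_iff)

lemma kron_vec_of: "kron A B *v vec_of X = vec_of (B ** X ** transpose A)"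
  for A :: "real^'n^'m" and B :: "real^'l^'k"
proof -
  have "(\<Sum>c\<in>UNIV. A $ a $ fst c * B $ b $ snd c * X $ snd c $ fst c)
      = (\<Sum>n\<in>UNIV. (\<Sum>l\<in>UNIV. B $ b $ l * X $ l $ n) * A $ a $ n)" for a b
    by (simp add: sum.cartesian_product case_prod_unfold sum_distrib_right sum_distrib_left mult_ac)
  then show ?thesis
    by (simp add: vec_eq_iff kron_def vec_of_def matrix_vector_mult_def matrix_matrix_mult_def transpose_def)
qed

lemma kron_vec_inner_vec_of: "kron_vec u v \<bullet> vec_of Y = v \<bullet> (Y *v u)" for Y :: "real^'n^'m"
proof -
  have "kron_vec u v \<bullet> vec_of Y = (\<Sum>j\<in>UNIV. \<Sum>i\<in>UNIV. v $ i * (Y $ i $ j * u $ j))"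
    by (simp add: inner_vec_def vec_of_def kron_vec_def sum.cartesian_product case_prod_unfold mult_ac)
  also have "\<dots> = v \<bullet> (Y *v u)"
    by (subst sum.swap) (simp add: inner_vec_def matrix_vector_mult_def sum_distrib_left)
  finally show ?thesis .
qed

lemma invertible_sylvester_kron:
  fixes A :: "real^'n^'n" and B :: "real^'m^'m"
  assumes "eigvals A \<inter> eigvals B = {}"
  shows "invertible (kron (transpose A) (mat 1) - kron (mat 1) B)"
proof -
  have "x = 0" if x: "(kron (transpose A) (mat 1) - kron (mat 1) B) *v x = 0" for x
  proof -
    obtain Y where Y: "x = vec_of Y" using surj_vec_of by blast
    have "vec_of (Y ** A - B ** Y) = 0"
      using x by (simp add: Y matrix_vector_mult_diff_rdistrib kron_vec_of vec_of_diff)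
    then have "Y ** A - B ** Y = 0" by (metis norm_eq_zero norm_vec_of)
    then have "Y = 0" by (intro sylvester_zero[OF assms]) simp
    then show "x = 0" by (metis Y norm_eq_zero norm_vec_of)
  qed
  then show ?thesis by (simp add: invertible_left_inverse matrix_left_invertible_ker)
qed

section \<open>Block matrices\<close>

lemma sum_UNIV_sum_type:
  "(\<Sum>x\<in>UNIV. f x) = (\<Sum>a\<in>UNIV. f (Inl a)) + (\<Sum>b\<in>UNIV. f (Inr b))"
  for f :: "'a::finite + 'b::finite \<Rightarrow> 'c::comm_monoid_add"
  by (subst UNIV_Plus_UNIV[symmetric], subst sum.Plus) simp_all

lemma mult_by_blocks: "A ** B = left_cols A ** upper_rows B + right_cols A ** lower_rows B"
  by (simp add: vec_eq_iff matrix_matrix_mult_def sum_UNIV_sum_type left_cols_def right_cols_def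
      upper_rows_def lower_rows_def)

lemma left_cols_mult: "left_cols (A ** B) = A ** left_cols B"
  by (simp add: vec_eq_iff matrix_matrix_mult_def left_cols_def)

lemma right_cols_mult: "right_cols (A ** B) = A ** right_cols B"
  by (simp add: vec_eq_iff matrix_matrix_mult_def right_cols_def)

lemma upper_rows_mult: "upper_rows (A ** B) = upper_rows A ** B"
  by (simp add: vec_eq_iff matrix_matrix_mult_def upper_rows_def)

lemma lower_rows_mult: "lower_rows (A ** B) = lower_rows A ** B"
  by (simp add: vec_eq_iff matrix_matrix_mult_def lower_rows_def)

lemma upper_rows_transpose: "upper_rows (transpose A) = transpose (left_cols A)"
  and lower_rows_transpose: "lower_rows (transpose A) = transpose (right_cols A)"
  by (simp_all add: vec_eq_iff transpose_def left_cols_def right_cols_def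
      upper_rows_def lower_rows_def)

lemma blocks_mat_1:
  "left_cols (upper_rows (mat 1)) = mat 1" "right_cols (lower_rows (mat 1)) = mat 1"
  by (simp_all add: vec_eq_iff mat_def left_cols_def right_cols_def upper_rows_def lower_rows_def)

lemma hcat_cols: "left_cols (hcat A B) = A" "right_cols (hcat A B) = B"
  by (simp_all add: vec_eq_iff hcat_def left_cols_def right_cols_def)

text \<open>
  The block forms of \<open>L\<^sup>T R = 1\<close>, \<open>R L\<^sup>T = 1\<close>, \<open>N R = R \<Lambda>\<close> and \<open>L\<^sup>T N = \<Lambda> L\<^sup>T\<close>. The vanishing lower
  left block of \<open>\<Lambda>\<close> makes the column space of \<open>R\<^sub>I\<close> invariant under \<open>N\<close> and that of \<open>L\<^sub>J\<close> invariant
  under \<open>N\<^sup>T\<close>.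
\<close>

lemma block_decomp_facts:
  assumes "block_decomp N R L \<Lambda>"
  shows "transpose (left_cols L) ** left_cols R = mat 1"
    "transpose (right_cols L) ** right_cols R = mat 1"
    "left_cols R ** transpose (left_cols L) + right_cols R ** transpose (right_cols L) = mat 1"
    "N ** left_cols R = left_cols R ** upper_rows (left_cols \<Lambda>)"
    "transpose (right_cols L) ** N = lower_rows (right_cols \<Lambda>) ** transpose (right_cols L)"
proof -
  have inv: "invertible R" and L: "transpose L = matrix_inv R"
    and \<Lambda>: "matrix_inv R ** N ** R = \<Lambda>" and z: "lower_rows (left_cols \<Lambda>) = 0"
    using assms by (simp_all add: block_decomp_def)
  have 1: "transpose L ** R = mat 1" and 2: "R ** transpose L = mat 1"
    using inv by (simp_all add: L matrix_inv_left matrix_inv_right)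
  have ul: "transpose (left_cols L) = upper_rows (transpose L)" "transpose (right_cols L) = lower_rows (transpose L)"
    by (simp_all add: upper_rows_transpose lower_rows_transpose)
  show "transpose (left_cols L) ** left_cols R = mat 1"
    "transpose (right_cols L) ** right_cols R = mat 1"
    unfolding ul upper_rows_mult[symmetric] lower_rows_mult[symmetric] left_cols_mult[symmetric]
      right_cols_mult[symmetric] 1
    by (rule blocks_mat_1)+
  show "left_cols R ** transpose (left_cols L) + right_cols R ** transpose (right_cols L) = mat 1"
    unfolding ul using 2 by (simp add: mult_by_blocks)
  have NR: "N ** R = R ** \<Lambda>" and LN: "transpose L ** N = \<Lambda> ** transpose L"
    unfolding \<Lambda>[symmetric] L[symmetric] using 1 2 by (metis matrix_mul_assoc matrix_mul_lid matrix_mul_rid)+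
  have "left_cols (N ** R) = R ** left_cols \<Lambda>" by (simp add: NR left_cols_mult)
  then show "N ** left_cols R = left_cols R ** upper_rows (left_cols \<Lambda>)"
    by (simp add: left_cols_mult mult_by_blocks[of R] z)
  have "lower_rows (transpose L ** N) = lower_rows \<Lambda> ** transpose L" by (simp add: LN lower_rows_mult)
  then show "transpose (right_cols L) ** N = lower_rows (right_cols \<Lambda>) ** transpose (right_cols L)"
    unfolding ul lower_rows_mult mult_by_blocks[of "lower_rows \<Lambda>"]
    using z by (simp add: vec_eq_iff left_cols_def right_cols_def lower_rows_def matrix_matrix_mult_def)
qed

section \<open>Continuity and measurability of matrix operations\<close>

lemma tendsto_hcat [tendsto_intros]:
  assumes "(f \<longlongrightarrow> a) F" "(g \<longlongrightarrow> b) F"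
  shows "((\<lambda>x. hcat (f x) (g x)) \<longlongrightarrow> hcat a b) F"
  unfolding hcat_def
proof (intro tendsto_vec_lambda)
  fix i j
  show "((\<lambda>x. case j of Inl k \<Rightarrow> f x $ i $ k | Inr k \<Rightarrow> g x $ i $ k)
      \<longlongrightarrow> (case j of Inl k \<Rightarrow> a $ i $ k | Inr k \<Rightarrow> b $ i $ k)) F"
    using assms by (cases j) (auto intro!: tendsto_intros)
qed

lemma tendsto_left_cols [tendsto_intros]:
  "(f \<longlongrightarrow> a) F \<Longrightarrow> ((\<lambda>x. left_cols (f x)) \<longlongrightarrow> left_cols a) F"
  unfolding left_cols_def by (intro tendsto_intros)

lemma tendsto_right_cols [tendsto_intros]:
  "(f \<longlongrightarrow> a) F \<Longrightarrow> ((\<lambda>x. right_cols (f x)) \<longlongrightarrow> right_cols a) F"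
  unfolding right_cols_def by (intro tendsto_intros)

lemma tendsto_upper_rows [tendsto_intros]:
  "(f \<longlongrightarrow> a) F \<Longrightarrow> ((\<lambda>x. upper_rows (f x)) \<longlongrightarrow> upper_rows a) F"
  unfolding upper_rows_def by (intro tendsto_intros)

lemma tendsto_lower_rows [tendsto_intros]:
  "(f \<longlongrightarrow> a) F \<Longrightarrow> ((\<lambda>x. lower_rows (f x)) \<longlongrightarrow> lower_rows a) F"
  unfolding lower_rows_def by (intro tendsto_intros)

lemma tendsto_transpose [tendsto_intros]:
  "(f \<longlongrightarrow> a) F \<Longrightarrow> ((\<lambda>x. transpose (f x)) \<longlongrightarrow> transpose a) F"
  unfolding transpose_def by (intro tendsto_intros)

lemma tendsto_vec_of [tendsto_intros]:
  "(f \<longlongrightarrow> a) F \<Longrightarrow> ((\<lambda>x. vec_of (f x)) \<longlongrightarrow> vec_of a) F"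
  unfolding vec_of_def by (intro tendsto_intros)

lemma tendsto_matrix_matrix_mult [tendsto_intros]:
  "(f \<longlongrightarrow> a) F \<Longrightarrow> (g \<longlongrightarrow> b) F \<Longrightarrow> ((\<lambda>x. (f x) ** (g x)) \<longlongrightarrow> a ** b) F"
  for a :: "real^_^_" and b :: "real^_^_"
  unfolding matrix_matrix_mult_def by (intro tendsto_intros)

lemma tendsto_vector_matrix_mult [tendsto_intros]:
  "(f \<longlongrightarrow> a) F \<Longrightarrow> (g \<longlongrightarrow> b) F \<Longrightarrow> ((\<lambda>x. (f x) v* (g x)) \<longlongrightarrow> a v* b) F"
  for a :: "real^_" and b :: "real^_^_"
  unfolding vector_matrix_mult_def by (intro tendsto_intros)

lemma tendsto_matrix_vector_mult [tendsto_intros]: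
  "(f \<longlongrightarrow> a) F \<Longrightarrow> (g \<longlongrightarrow> b) F \<Longrightarrow> ((\<lambda>x. (f x) *v (g x)) \<longlongrightarrow> a *v b) F"
  for a :: "real^_^_" and b :: "real^_"
  unfolding matrix_vector_mult_def by (intro tendsto_intros)

lemma tendsto_kron [tendsto_intros]:
  "(f \<longlongrightarrow> a) F \<Longrightarrow> (g \<longlongrightarrow> b) F \<Longrightarrow> ((\<lambda>x. kron (f x) (g x)) \<longlongrightarrow> kron a b) F"
  for a :: "real^_^_" and b :: "real^_^_"
  unfolding kron_def by (intro tendsto_intros)

lemma tendsto_kron_vec [tendsto_intros]:
  "(f \<longlongrightarrow> a) F \<Longrightarrow> (g \<longlongrightarrow> b) F \<Longrightarrow> ((\<lambda>x. kron_vec (f x) (g x)) \<longlongrightarrow> kron_vec a b) F"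
  for a :: "real^_" and b :: "real^_"
  unfolding kron_vec_def by (intro tendsto_intros)

lemma continuous_on_det: "continuous_on UNIV (det :: real^'n^'n \<Rightarrow> real)"
  unfolding det_def by (intro continuous_intros)

lemma matrix_inv_entry:
  fixes A :: "real^'n^'n"
  assumes "det A \<noteq> 0"
  shows "matrix_inv A $ k $ l = det (\<chi> i j. if j = k then (axis l 1 :: real^'n) $ i else A $ i $ j) / det A"
proof -
  have "A *v (matrix_inv A *v axis l 1) = axis l 1"
    using assms by (simp add: matrix_vector_mul_assoc matrix_inv_right invertible_det_nz)
  then have "(matrix_inv A *v axis l 1) $ k
      = det (\<chi> i j. if j = k then (axis l 1 :: real^'n) $ i else A $ i $ j) / det A"
    unfolding cramer[OF assms] by simp
  then show ?thesis by (simp add: matrix_vector_mul_component inner_axis)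
qed

text \<open>
  Cramer's rule exhibits the entries of the inverse as quotients of polynomials in those of the
  matrix.
\<close>

lemma tendsto_matrix_inv:
  fixes A :: "real^'n^'n"
  assumes f: "(f \<longlongrightarrow> A) F" and inv: "invertible A"
  shows "((\<lambda>x. matrix_inv (f x)) \<longlongrightarrow> matrix_inv A) F"
proof (intro vec_tendstoI)
  fix k l
  have A: "det A \<noteq> 0" using inv by (simp add: invertible_det_nz)
  have td: "((\<lambda>x. det (g x)) \<longlongrightarrow> det B) F" if "(g \<longlongrightarrow> B) F" for g and B :: "real^'n^'n"
    using continuous_on_tendsto_compose[OF continuous_on_det that] by simp
  have "((\<lambda>x. det (\<chi> i j. if j = k then (axis l 1 :: real^'n) $ i else f x $ i $ j) / det (f x))
      \<longlongrightarrow> det (\<chi> i j. if j = k then (axis l 1 :: real^'n) $ i else A $ i $ j) / det A) F"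
    by (intro tendsto_divide td f A tendsto_vec_lambda) (auto intro!: tendsto_intros f)
  moreover have "\<forall>\<^sub>F x in F. det (f x) \<noteq> 0"
    using td[OF f] A by (rule tendsto_imp_eventually_ne)
  ultimately show "((\<lambda>x. matrix_inv (f x) $ k $ l) \<longlongrightarrow> matrix_inv A $ k $ l) F"
    unfolding matrix_inv_entry[OF A]
    by (elim Lim_transform_eventually) (auto elim: eventually_mono simp: matrix_inv_entry)
qed

lemma eventually_invertible:
  fixes A :: "real^'n^'n"
  assumes "(f \<longlongrightarrow> A) F" "invertible A"
  shows "\<forall>\<^sub>F x in F. invertible (f x)"
  using tendsto_imp_eventually_ne[OF continuous_on_tendsto_compose[OF continuous_on_det assms(1)]] assms(2)
  by (simp add: invertible_det_nz)

lemma borel_measurable_vecI: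
  fixes f :: "'a \<Rightarrow> 'b::euclidean_space^'n"
  assumes "\<And>i. (\<lambda>x. f x $ i) \<in> borel_measurable M"
  shows "f \<in> borel_measurable M"
  unfolding borel_measurable_euclidean_space[of f] Basis_vec_def
  using assms by (auto simp: inner_axis)

text \<open>
  Cramer's rule covers the invertible matrices; all others are mapped to one and the same
  unspecified matrix, because the property that \<^const>\<open>matrix_inv\<close> chooses by is then satisfied by
  no matrix.
\<close>

lemma borel_measurable_matrix_inv [measurable]:
  "(matrix_inv :: real^'n^'n \<Rightarrow> real^'n^'n) \<in> borel_measurable borel"
proof (intro borel_measurable_vecI)
  fix k l
  have [measurable]: "(det :: real^'n^'n \<Rightarrow> real) \<in> borel_measurable borel"
    by (rule borel_measurable_continuous_onI[OF continuous_on_det])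
  have cof: "continuous_on UNIV (\<lambda>A :: real^'n^'n. det (\<chi> i j. if j = k then (axis l 1 :: real^'n) $ i else A $ i $ j))"
  proof (intro continuous_on_compose2[OF continuous_on_det] continuous_on_vec_lambda)
    fix i j :: 'n
    show "continuous_on UNIV (\<lambda>A :: real^'n^'n. if j = k then (axis l 1 :: real^'n) $ i else A $ i $ j)"
      by (cases "j = k") (auto intro!: continuous_intros)
  qed simp
  note [measurable] = borel_measurable_continuous_onI[OF cof]
  have eq: "matrix_inv A $ k $ l = (if det A = 0 then (SOME B :: real^'n^'n. False) $ k $ l
      else det (\<chi> i j. if j = k then (axis l 1 :: real^'n) $ i else A $ i $ j) / det A)"
    for A :: "real^'n^'n"
  proof (cases "det A = 0")
    case True
    then have "\<not> invertible A" by (simp add: invertible_det_nz)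
    then have "(\<lambda>B. A ** B = mat 1 \<and> B ** A = mat 1) = (\<lambda>B. False)"
      by (auto simp: invertible_def)
    then show ?thesis using True by (simp add: matrix_inv_def)
  qed (simp add: matrix_inv_entry)
  show "(\<lambda>A :: real^'n^'n. matrix_inv A $ k $ l) \<in> borel_measurable borel"
    unfolding eq by measurable
qed

section \<open>The increment of the coefficient as an exact linear form\<close>

text \<open>
  The matrix of \<open>Y \<mapsto> Y A - B Y\<close> in column-stacked coordinates.
\<close>

definition sylvester_mat :: "real^'q^'q \<Rightarrow> real^'r^'r \<Rightarrow> real^('q \<times> 'r)^('q \<times> 'r)" where
  "sylvester_mat A B = kron (transpose A) (mat 1) - kron (mat 1) B"

text \<open>
  The row \<open>e\<^sub>j\<^sup>T \<upsilon>\<^sub>\<bottom>\<^sup>T R\<^sub>J\<close>, with \<open>V\<close> in the place of \<open>R\<^sub>I\<^sub>,\<^sub>2\<^sup>-\<^sup>1\<close>; here and in the next definition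
  the inverses are arguments, so that the expressions are polynomial, hence continuous everywhere.
\<close>

definition row_weight :: "'r \<Rightarrow> real^('q::finite + 'r::finite)^('r + 'q) \<Rightarrow> real^'q^'q \<Rightarrow> real^'r" where
  "row_weight j R V = axis j 1 v* (hcat (mat 1) (- (upper_rows (left_cols R) ** V)) ** right_cols R)"

text \<open>
  The expression for \<open>B\<^sub>i\<^sub>j\<close> with independent ingredients: the exact increment of the coefficient
  between \<open>M\<close> and \<open>N\<close> mixes ingredients taken at \<open>M\<close> with ingredients taken at \<open>N\<close>.
\<close>

definition slope_row :: "'q \<Rightarrow> real^'r \<Rightarrow> real^'q^'q \<Rightarrow> real^('q \<times> 'r)^('q \<times> 'r) \<Rightarrow>
    real^'q^('r + 'q) \<Rightarrow> real^'r^('r + 'q) \<Rightarrow> real^(('r::finite + 'q::finite) \<times> ('r + 'q))" where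
  "slope_row i w V K A C = kron_vec (axis i 1 v* transpose V) w v* K v* kron (transpose A) (transpose C)"

lemma B_row_eq_slope_row:
  "B_row i j R L \<Lambda> = slope_row i (row_weight j R (matrix_inv (lower_rows (left_cols R))))
     (matrix_inv (lower_rows (left_cols R)))
     (matrix_inv (sylvester_mat (upper_rows (left_cols \<Lambda>)) (lower_rows (right_cols \<Lambda>))))
     (left_cols R) (right_cols L)"
  by (simp add: B_row_def slope_row_def row_weight_def sylvester_mat_def upsilon_perp_T_def D_mat_def)

lemma d_coef_eq:
  "d_coef i j R = axis j 1 \<bullet> ((upper_rows (left_cols R) ** matrix_inv (lower_rows (left_cols R))) *v axis i 1)"
  unfolding d_coef_def D_mat_def transpose_matrix_vector
  by (metis dot_lmul_matrix inner_commute)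

lemma slope_row_inner:
  "slope_row i w V K A C \<bullet> vec_of X
     = kron_vec (V *v axis i 1) w \<bullet> (K *v vec_of (transpose C ** X ** A))"
  unfolding slope_row_def by (simp add: dot_lmul_matrix kron_vec_of)

lemma sylvester_mat_vec_of: "sylvester_mat A B *v vec_of Y = vec_of (Y ** A - B ** Y)"
  by (simp add: sylvester_mat_def matrix_vector_mult_diff_rdistrib kron_vec_of vec_of_diff)

lemma matrix_add_rdistrib: "(A + B) ** C = A ** C + B ** C"
  by (simp add: vec_eq_iff matrix_matrix_mult_def distrib_right sum.distrib)

lemma matrix_diff_ldistrib: "A ** (B - C) = A ** B - A ** C"
  and matrix_diff_rdistrib: "(D - E) ** F = D ** F - E ** F"
  for A B C D E F :: "'a::ring_1^_^_"
  by (simp_all add: vec_eq_iff matrix_matrix_mult_def right_diff_distrib left_diff_distrib sum_subtractf)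

lemma upsilon_mult:
  "hcat (mat 1) (- T) ** A = upper_rows A - T ** lower_rows A"
  for T :: "real^'q^'r"
proof -
  have "(- T) ** lower_rows A = - (T ** lower_rows A)"
    by (simp add: vec_eq_iff matrix_matrix_mult_def sum_negf)
  then show ?thesis by (simp add: mult_by_blocks[of "hcat _ _"] hcat_cols)
qed

lemma upsilon_mult_left_cols:
  fixes R :: "real^('q::finite + 'r::finite)^('r + 'q)"
  assumes "invertible (lower_rows (left_cols R))"
  shows "hcat (mat 1) (- (upper_rows (left_cols R) ** matrix_inv (lower_rows (left_cols R)))) ** left_cols R = 0"
  using assms by (simp add: upsilon_mult matrix_inv_left flip: matrix_mul_assoc)

text \<open>
  Primes denote quantities at \<open>N\<close>. Since \<open>\<upsilon>\<^sub>\<bottom>\<^sup>T = [1, -D\<^sup>T]\<close> annihilates \<open>R\<^sub>I\<close> and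
  \<open>R\<^sub>I L\<^sub>I\<^sup>T + R\<^sub>J L\<^sub>J\<^sup>T = 1\<close>,
  \<open>D'\<^sup>T - D\<^sup>T = \<upsilon>\<^sub>\<bottom>\<^sup>T R'\<^sub>I R'\<^sub>I\<^sub>,\<^sub>2\<^sup>-\<^sup>1 = \<upsilon>\<^sub>\<bottom>\<^sup>T R\<^sub>J Y R'\<^sub>I\<^sub>,\<^sub>2\<^sup>-\<^sup>1\<close> with \<open>Y = L\<^sub>J\<^sup>T R'\<^sub>I\<close>. Multiplying
  \<open>N R'\<^sub>I = R'\<^sub>I \<Lambda>'\<^sub>I\<close> by \<open>L\<^sub>J\<^sup>T\<close> and using \<open>L\<^sub>J\<^sup>T M = \<Lambda>\<^sub>J L\<^sub>J\<^sup>T\<close> gives the Sylvester equation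
  \<open>Y \<Lambda>'\<^sub>I - \<Lambda>\<^sub>J Y = L\<^sub>J\<^sup>T (N - M) R'\<^sub>I\<close>, which determines \<open>Y\<close>. All steps are identities, so that
  there is no remainder term.
\<close>

lemma d_coef_diff_eq_slope:
  fixes R R' :: "real^('q::finite + 'r::finite)^('r + 'q)"
  assumes M: "block_decomp M R L \<Lambda>" and N: "block_decomp N R' L' \<Lambda>'"
    and R2: "invertible (lower_rows (left_cols R))"
    and R2': "invertible (lower_rows (left_cols R'))"
    and K: "invertible (sylvester_mat (upper_rows (left_cols \<Lambda>')) (lower_rows (right_cols \<Lambda>)))"
  shows "d_coef i j R' - d_coef i j R
    = slope_row i (row_weight j R (matrix_inv (lower_rows (left_cols R))))
        (matrix_inv (lower_rows (left_cols R')))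
        (matrix_inv (sylvester_mat (upper_rows (left_cols \<Lambda>')) (lower_rows (right_cols \<Lambda>))))
        (left_cols R') (right_cols L) \<bullet> vec_of (N - M)"
proof -
  let ?V = "matrix_inv (lower_rows (left_cols R))" and ?V' = "matrix_inv (lower_rows (left_cols R'))"
  let ?LJ = "transpose (right_cols L)"
  let ?A = "upper_rows (left_cols \<Lambda>')" and ?B = "lower_rows (right_cols \<Lambda>)"
  define T where "T = upper_rows (left_cols R) ** ?V"
  define T' where "T' = upper_rows (left_cols R') ** ?V'"
  define up where "up = hcat (mat 1) (- T)"
  define Y where "Y = ?LJ ** left_cols R'"
  have up_RI: "up ** left_cols R = 0"
    unfolding up_def T_def by (rule upsilon_mult_left_cols[OF R2])
  have "up ** left_cols R' = up ** (left_cols R ** transpose (left_cols L) + right_cols R ** ?LJ) ** left_cols R'"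
    by (simp add: block_decomp_facts(3)[OF M])
  also have "\<dots> = up ** right_cols R ** Y"
    by (simp add: matrix_add_ldistrib matrix_add_rdistrib matrix_mul_assoc up_RI Y_def)
  finally have up_RI': "up ** left_cols R' = up ** right_cols R ** Y" .
  have "T' - T = up ** left_cols R' ** ?V'"
    using R2' by (simp add: up_def upsilon_mult T'_def matrix_diff_rdistrib matrix_inv_right flip: matrix_mul_assoc)
  then have TT: "T' - T = up ** right_cols R ** Y ** ?V'" by (simp add: up_RI')
  have "Y ** ?A = ?LJ ** N ** left_cols R'"
    by (simp add: Y_def block_decomp_facts(4)[OF N] flip: matrix_mul_assoc)
  moreover have "?B ** Y = ?LJ ** M ** left_cols R'"
    by (simp add: Y_def matrix_mul_assoc block_decomp_facts(5)[OF M])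
  ultimately have syl: "Y ** ?A - ?B ** Y = ?LJ ** (N - M) ** left_cols R'"
    by (simp add: matrix_diff_ldistrib matrix_diff_rdistrib)
  have "matrix_inv (sylvester_mat ?A ?B) *v vec_of (?LJ ** (N - M) ** left_cols R') = vec_of Y"
    unfolding syl[symmetric] sylvester_mat_vec_of[symmetric]
    using K by (simp add: matrix_vector_mul_assoc matrix_inv_left)
  then have "slope_row i (row_weight j R ?V) ?V' (matrix_inv (sylvester_mat ?A ?B))
        (left_cols R') (right_cols L) \<bullet> vec_of (N - M)
      = row_weight j R ?V \<bullet> (Y *v (?V' *v axis i 1))"
    by (simp add: slope_row_inner kron_vec_inner_vec_of)
  also have "\<dots> = axis j 1 \<bullet> ((T' - T) *v axis i 1)"
  proof -
    have "row_weight j R ?V = axis j 1 v* (up ** right_cols R)"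
      by (simp add: row_weight_def up_def T_def)
    then show ?thesis
      by (simp add: dot_lmul_matrix TT matrix_vector_mul_assoc matrix_mul_assoc)
  qed
  also have "\<dots> = d_coef i j R' - d_coef i j R"
    by (simp add: d_coef_eq T_def T'_def matrix_vector_mult_diff_rdistrib inner_diff_right)
  finally show ?thesis by simp
qed

text \<open>
  The map \<open>X \<mapsto> L\<^sub>J\<^sup>T X R\<^sub>I\<close> is onto, with \<open>X = R\<^sub>J Z L\<^sub>I\<^sup>T\<close> mapped to \<open>Z\<close>. Choosing \<open>Z\<close> as the Sylvester
  image of an arbitrary \<open>Y\<close> gives \<open>B\<^sub>i\<^sub>j vec X = w \<bullet> Y u\<close>, where \<open>u = R\<^sub>I\<^sub>,\<^sub>2\<^sup>-\<^sup>1 e\<^sub>i\<close> and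
  \<open>w\<^sup>T = e\<^sub>j\<^sup>T \<upsilon>\<^sub>\<bottom>\<^sup>T R\<^sub>J\<close>. Both are nonzero: if \<open>w\<close> vanished, \<open>e\<^sub>j\<^sup>T \<upsilon>\<^sub>\<bottom>\<^sup>T\<close> would annihilate all of
  \<open>R = [R\<^sub>I R\<^sub>J]\<close> and so vanish, but its entry at \<open>j\<close> is 1.
\<close>

lemma B_row_nonzero:
  fixes R :: "real^('q::finite + 'r::finite)^('r + 'q)"
  assumes M: "block_decomp M R L \<Lambda>"
    and R2: "invertible (lower_rows (left_cols R))"
    and disj: "eigvals (upper_rows (left_cols \<Lambda>)) \<inter> eigvals (lower_rows (right_cols \<Lambda>)) = {}"
  shows "B_row i j R L \<Lambda> \<noteq> 0"
proof
  assume B0: "B_row i j R L \<Lambda> = 0"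
  let ?V = "matrix_inv (lower_rows (left_cols R))"
  let ?A = "upper_rows (left_cols \<Lambda>)" and ?B = "lower_rows (right_cols \<Lambda>)"
  define T where "T = upper_rows (left_cols R) ** ?V"
  define up where "up = hcat (mat 1) (- T)"
  define w where "w = row_weight j R ?V"
  define u where "u = ?V *v axis i 1"
  have K: "invertible (sylvester_mat ?A ?B)"
    unfolding sylvester_mat_def by (rule invertible_sylvester_kron[OF disj])
  have all: "w \<bullet> (Y *v u) = 0" for Y
  proof -
    define Z where "Z = Y ** ?A - ?B ** Y"
    define X where "X = right_cols R ** Z ** transpose (left_cols L)"
    have "transpose (right_cols L) ** X ** left_cols R
        = (transpose (right_cols L) ** right_cols R) ** Z ** (transpose (left_cols L) ** left_cols R)"
      by (simp only: X_def matrix_mul_assoc)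
    also have "\<dots> = Z" by (simp add: block_decomp_facts[OF M])
    finally have XZ: "transpose (right_cols L) ** X ** left_cols R = Z" .
    have "matrix_inv (sylvester_mat ?A ?B) *v vec_of Z = vec_of Y"
      unfolding Z_def sylvester_mat_vec_of[symmetric]
      using K by (simp add: matrix_vector_mul_assoc matrix_inv_left)
    then have "B_row i j R L \<Lambda> \<bullet> vec_of X = w \<bullet> (Y *v u)"
      by (simp add: B_row_eq_slope_row slope_row_inner XZ kron_vec_inner_vec_of w_def u_def)
    then show ?thesis by (simp add: B0)
  qed
  have "u \<noteq> 0"
  proof
    assume "u = 0"
    then have "lower_rows (left_cols R) *v u = 0" by simp
    then show False using R2 by (simp add: u_def matrix_vector_mul_assoc matrix_inv_right axis_eq_0_iff)
  qed
  moreover have "w \<noteq> 0"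
  proof
    assume "w = 0"
    have up_RI: "up ** left_cols R = 0"
      unfolding up_def T_def by (rule upsilon_mult_left_cols[OF R2])
    have "axis j 1 v* up = axis j 1 v* (up ** (left_cols R ** transpose (left_cols L)
        + right_cols R ** transpose (right_cols L)))"
      by (simp add: block_decomp_facts(3)[OF M])
    also have "\<dots> = axis j 1 v* (up ** right_cols R ** transpose (right_cols L))"
      by (simp add: matrix_add_ldistrib matrix_mul_assoc up_RI)
    also have "\<dots> = w v* transpose (right_cols L)"
      by (simp add: w_def row_weight_def up_def T_def flip: vector_matrix_mul_assoc)
    also have "\<dots> = 0" using \<open>w = 0\<close> by simp
    finally have "(axis j 1 v* up) $ Inl j = 0" by simp
    then show False
      by (simp add: up_def hcat_def vector_matrix_mult_def axis_def mat_def if_distrib if_distribR cong: if_cong)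
  qed
  moreover have "w \<bullet> ((\<chi> a b. w $ a * u $ b) *v u) = (w \<bullet> w) * (u \<bullet> u)"
    by (simp add: inner_vec_def matrix_vector_mult_def sum_distrib_left sum_distrib_right mult_ac)
  ultimately show False using all[of "\<chi> a b. w $ a * u $ b"] by simp
qed

lemma tendsto_slope_row [tendsto_intros]:
  assumes "(w \<longlongrightarrow> w0) F" "(V \<longlongrightarrow> V0) F" "(K \<longlongrightarrow> K0) F" "(A \<longlongrightarrow> A0) F" "(C \<longlongrightarrow> C0) F"
  shows "((\<lambda>x. slope_row i (w x) (V x) (K x) (A x) (C x)) \<longlongrightarrow> slope_row i w0 V0 K0 A0 C0) F"
  unfolding slope_row_def by (intro tendsto_intros assms)

lemma tendsto_row_weight [tendsto_intros]:
  assumes "(R \<longlongrightarrow> R0) F" "(V \<longlongrightarrow> V0) F"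
  shows "((\<lambda>x. row_weight j (R x) (V x)) \<longlongrightarrow> row_weight j R0 V0) F"
  unfolding row_weight_def by (intro tendsto_intros assms)

lemma tendsto_sylvester_mat [tendsto_intros]:
  assumes "(A \<longlongrightarrow> A0) F" "(B \<longlongrightarrow> B0) F"
  shows "((\<lambda>x. sylvester_mat (A x) (B x)) \<longlongrightarrow> sylvester_mat A0 B0) F"
  unfolding sylvester_mat_def by (intro tendsto_intros assms)

lemma tendsto_sigma2:
  assumes "(R \<longlongrightarrow> R0) F" "(L \<longlongrightarrow> L0) F" "(\<Lambda> \<longlongrightarrow> \<Lambda>0) F" "(\<Omega> \<longlongrightarrow> \<Omega>0) F"
    and "invertible (lower_rows (left_cols R0))"
    and "invertible (sylvester_mat (upper_rows (left_cols \<Lambda>0)) (lower_rows (right_cols \<Lambda>0)))"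
  shows "((\<lambda>x. sigma2 i j (R x) (L x) (\<Lambda> x) (\<Omega> x)) \<longlongrightarrow> sigma2 i j R0 L0 \<Lambda>0 \<Omega>0) F"
  unfolding sigma2_def B_row_eq_slope_row
  by (intro tendsto_intros tendsto_matrix_inv assms)

text \<open>
  Measurability through continuity, in a form whose premise is proved by the limit rules.
\<close>

lemma borel_measurable_tendsto:
  assumes "\<And>x F. ((\<lambda>y. y) \<longlongrightarrow> x) F \<Longrightarrow> (f \<longlongrightarrow> f x) F"
  shows "f \<in> borel_measurable borel"
  by (intro borel_measurable_continuous_onI) (auto simp: continuous_on_def intro!: assms tendsto_ident_at)

lemma borel_measurable_blocks [measurable]:
  "(\<lambda>R :: real^('q::finite + 'r::finite)^('r + 'q). lower_rows (left_cols R)) \<in> borel_measurable borel"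
  by (rule borel_measurable_tendsto, intro tendsto_intros)

lemma borel_measurable_sylvester_mat [measurable]:
  "(\<lambda>\<Lambda> :: real^('q::finite + 'r::finite)^('q + 'r). sylvester_mat (upper_rows (left_cols \<Lambda>)) (lower_rows (right_cols \<Lambda>)))
    \<in> borel_measurable borel"
  by (rule borel_measurable_tendsto, intro tendsto_intros)

lemma borel_measurable_d_coef [measurable]:
  "(d_coef i j :: real^('q::finite + 'r::finite)^('r + 'q) \<Rightarrow> real) \<in> borel_measurable borel"
proof -
  let ?f = "\<lambda>p :: (real^('q + 'r)^('r + 'q)) \<times> (real^'q^'q). axis j 1 \<bullet> ((upper_rows (left_cols (fst p)) ** snd p) *v axis i 1)"
  have "?f \<in> borel_measurable borel"
    by (rule borel_measurable_tendsto, intro tendsto_intros)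
  from measurable_compose[OF borel_measurable_Pair this]
  have "(\<lambda>R. ?f (R, matrix_inv (lower_rows (left_cols R)))) \<in> borel_measurable borel"
    by measurable
  then show ?thesis by (simp add: d_coef_eq[abs_def])
qed

lemma borel_measurable_sigma2:
  fixes R L :: "'w \<Rightarrow> real^('q::finite + 'r::finite)^('r + 'q)"
  assumes [measurable]: "R \<in> borel_measurable P" "L \<in> borel_measurable P" "\<Lambda> \<in> borel_measurable P"
    "\<Omega> \<in> borel_measurable P"
  shows "(\<lambda>\<omega>. sigma2 i j (R \<omega>) (L \<omega>) (\<Lambda> \<omega>) (\<Omega> \<omega>)) \<in> borel_measurable P"
proof -
  define b where "b p = (case p of (R, V, K, L) \<Rightarrow> slope_row i (row_weight j R V) V K (left_cols R) (right_cols L))"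
    for p :: "(real^('q + 'r)^('r + 'q)) \<times> (real^'q^'q) \<times> (real^('q \<times> 'r)^('q \<times> 'r)) \<times> (real^('q + 'r)^('r + 'q))"
  have b_lim [tendsto_intros]: "((\<lambda>x. b (f x)) \<longlongrightarrow> b p) F" if "(f \<longlongrightarrow> p) F" for f p and F :: "'z filter"
    unfolding b_def case_prod_unfold by (intro tendsto_intros that)
  let ?f = "\<lambda>p. (b (fst p) v* snd p) \<bullet> b (fst p)"
  have "?f \<in> borel_measurable borel"
    by (rule borel_measurable_tendsto, intro tendsto_intros)
  from measurable_compose[OF borel_measurable_Pair this]
  have "(\<lambda>\<omega>. ?f ((R \<omega>, matrix_inv (lower_rows (left_cols (R \<omega>))),
      matrix_inv (sylvester_mat (upper_rows (left_cols (\<Lambda> \<omega>))) (lower_rows (right_cols (\<Lambda> \<omega>)))), L \<omega>), \<Omega> \<omega>))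
    \<in> borel_measurable P"
    by measurable
  then show ?thesis by (simp add: b_def sigma2_def B_row_eq_slope_row)
qed

section \<open>Asymptotic normality of the studentized coefficient\<close>

theorem theorem3:
  fixes P :: "'w measure"
    and M :: "real^('r::finite + 'q::finite)^('r + 'q)"
    and R L :: "real^('r + 'q)^('r + 'q) \<Rightarrow> real^('q + 'r)^('r + 'q)"
    and \<Lambda> :: "real^('r + 'q)^('r + 'q) \<Rightarrow> real^('q + 'r)^('q + 'r)"
    and U :: "(real^('r + 'q)^('r + 'q)) set"
    and lam :: "nat \<Rightarrow> complex"
    and G :: "real^'q^('r + 'q)"
    and \<epsilon> Mdat Mhat :: "nat \<Rightarrow> 'w \<Rightarrow> real^('r + 'q)^('r + 'q)"
    and \<Omega> :: "real^(('r + 'q) \<times> ('r + 'q))^(('r + 'q) \<times> ('r + 'q))"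
    and \<Omega>hat :: "nat \<Rightarrow> 'w \<Rightarrow> real^(('r + 'q) \<times> ('r + 'q))^(('r + 'q) \<times> ('r + 'q))"
    and i :: 'q and j :: 'r and d0 :: real
  assumes prob: "prob_space P"
    and nbhd: "open U" "M \<in> U"
    and decomp: "\<And>N. N \<in> U \<Longrightarrow> block_decomp N (R N) (L N) (\<Lambda> N)"
    and smooth: "smooth_on U R" "smooth_on U L" "smooth_on U \<Lambda>"
    and spectra_disjoint:
      "eigvals (upper_rows (left_cols (\<Lambda> M))) \<inter> eigvals (lower_rows (right_cols (\<Lambda> M))) = {}"
    and spectrum_cnj:
      "cnj ` eigvals (upper_rows (left_cols (\<Lambda> M))) = eigvals (upper_rows (left_cols (\<Lambda> M)))"
    and eigenvalues: "eigenvalue_list M lam"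
    and leading: "eigvals (upper_rows (left_cols (\<Lambda> M))) = lam ` {1..CARD('q)}"
    and gap: "cmod (lam (CARD('q))) > cmod (lam (CARD('q) + 1))"
    and G_rank: "rank G = CARD('q)" "rank (transpose G ** left_cols (R M)) = CARD('q)"
    and RI2_rank: "rank (lower_rows (left_cols (R M))) = CARD('q)"
    and noise_meas: "\<And>t. t \<ge> 1 \<Longrightarrow> (\<lambda>\<omega>. vec_of (\<epsilon> t \<omega>)) \<in> borel_measurable P"
    and ident_distr: "\<And>t. t \<ge> 1 \<Longrightarrow>
      distr P borel (\<lambda>\<omega>. vec_of (\<epsilon> t \<omega>)) = distr P borel (\<lambda>\<omega>. vec_of (\<epsilon> 1 \<omega>))"
    and mean_zero: "\<And>t. t \<ge> 1 \<Longrightarrow> has_mean P (\<lambda>\<omega>. vec_of (\<epsilon> t \<omega>)) 0"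
    and covariance: "\<And>t. t \<ge> 1 \<Longrightarrow> has_covariance P (\<lambda>\<omega>. vec_of (\<epsilon> t \<omega>)) \<Omega>"
    and Omega_pd: "positive_definite \<Omega>"
    and data: "\<And>t \<omega>. t \<ge> 1 \<Longrightarrow> Mdat t \<omega> = M + \<epsilon> t \<omega>"
    and Mhat: "\<And>T \<omega>. Mhat T \<omega> = (1 / real T) *\<^sub>R (\<Sum>t=1..T. Mdat t \<omega>)"
    and clt: "weak_conv_gen
      (\<lambda>T. distr P borel (\<lambda>\<omega>. sqrt (real T) *\<^sub>R vec_of (Mhat T \<omega> - M))) (mv_normal \<Omega>)"
    and Omegahat_meas: "\<And>T. \<Omega>hat T \<in> borel_measurable P"
    and Omegahat: "consistent_for P \<Omega>hat \<Omega>"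
    and hat_meas:
      "\<And>T. (\<lambda>\<omega>. R (Mhat T \<omega>)) \<in> borel_measurable P"
      "\<And>T. (\<lambda>\<omega>. L (Mhat T \<omega>)) \<in> borel_measurable P"
      "\<And>T. (\<lambda>\<omega>. \<Lambda> (Mhat T \<omega>)) \<in> borel_measurable P"
    and null: "d_coef i j (R M) = d0"
  shows "weak_conv_m
    (\<lambda>T. distr P borel (\<lambda>\<omega>.
       (d_coef i j (R (Mhat T \<omega>)) - d0) /
       sqrt (sigma2 i j (R (Mhat T \<omega>)) (L (Mhat T \<omega>)) (\<Lambda> (Mhat T \<omega>)) (\<Omega>hat T \<omega>) / real T)))
    std_normal_distribution"
proof -
  interpret prob_space P by (rule prob)
  \<comment> \<open>Near \<open>M\<close> the increment of the coefficient is \<open>\<beta> N \<bullet> vec (N - M)\<close>; dividing by the standard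
    error turns the statistic into \<open>\<gamma> (X T) \<bullet> Z T\<close>.\<close>
  define VN where "VN N = matrix_inv (lower_rows (left_cols (R N)))" for N
  define KN where "KN N = sylvester_mat (upper_rows (left_cols (\<Lambda> N))) (lower_rows (right_cols (\<Lambda> M)))" for N
  define \<beta> where "\<beta> N = slope_row i (row_weight j (R M) (VN M)) (VN N) (matrix_inv (KN N))
      (left_cols (R N)) (right_cols (L M))" for N
  define s where "s x = sigma2 i j (R (fst x)) (L (fst x)) (\<Lambda> (fst x)) (snd x)"
    for x :: "_ \<times> (real^(('r + 'q) \<times> ('r + 'q))^(('r + 'q) \<times> ('r + 'q)))"
  define \<gamma> where "\<gamma> x = (1 / sqrt (s x)) *\<^sub>R \<beta> (fst x)" for x
  define X where "X T \<omega> = (Mhat T \<omega>, \<Omega>hat T \<omega>)" for T \<omega>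
  define Z where "Z T \<omega> = sqrt (real T) *\<^sub>R vec_of (Mhat T \<omega> - M)" for T \<omega>
  define W where "W T \<omega> = (d_coef i j (R (Mhat T \<omega>)) - d0) /
       sqrt (sigma2 i j (R (Mhat T \<omega>)) (L (Mhat T \<omega>)) (\<Lambda> (Mhat T \<omega>)) (\<Omega>hat T \<omega>) / real T)" for T \<omega>

  have R2: "invertible (lower_rows (left_cols (R M)))"
    using RI2_rank by (simp add: full_rank_injective invertible_left_inverse matrix_left_invertible_injective)
  have K: "invertible (KN M)"
    unfolding KN_def sylvester_mat_def by (rule invertible_sylvester_kron[OF spectra_disjoint])
  have \<beta>M: "\<beta> M = B_row i j (R M) (L M) (\<Lambda> M)"
    by (simp add: \<beta>_def VN_def KN_def B_row_eq_slope_row)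

  have cont: "(f \<longlongrightarrow> f M) (nhds M)" if "smooth_on U f" for f :: "_ \<Rightarrow> 'z::real_normed_vector"
  proof -
    have "times_differentiable_on 0 U f" using that unfolding smooth_on_def by blast
    then have "isCont f M" using nbhd by (simp add: continuous_on_eq_continuous_at)
    then show ?thesis by (simp add: isCont_def tendsto_at_iff_tendsto_nhds)
  qed
  note R_lim = cont[OF smooth(1)] and L_lim = cont[OF smooth(2)] and \<Lambda>_lim = cont[OF smooth(3)]
  have R2_lim: "((\<lambda>N. lower_rows (left_cols (R N))) \<longlongrightarrow> lower_rows (left_cols (R M))) (nhds M)"
    by (intro tendsto_intros R_lim)
  have K_lim: "(KN \<longlongrightarrow> KN M) (nhds M)"
    unfolding KN_def by (intro tendsto_intros \<Lambda>_lim)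
  have \<beta>_lim: "(\<beta> \<longlongrightarrow> \<beta> M) (nhds M)"
    unfolding \<beta>_def VN_def by (intro tendsto_intros tendsto_matrix_inv R_lim K_lim R2 K)

  \<comment> \<open>All invertibility conditions are open, so the exact increment formula holds near \<open>M\<close>.\<close>
  have slope: "\<forall>\<^sub>F N in nhds M. d_coef i j (R N) - d0 = \<beta> N \<bullet> vec_of (N - M)"
  proof -
    have "\<forall>\<^sub>F N in nhds M. N \<in> U"
      using nbhd by (rule eventually_nhds_in_open)
    moreover have "\<forall>\<^sub>F N in nhds M. invertible (lower_rows (left_cols (R N)))"
      using eventually_invertible[OF R2_lim R2] .
    moreover have "\<forall>\<^sub>F N in nhds M. invertible (KN N)"
      using eventually_invertible[OF K_lim K] .
    ultimately show ?thesis
    proof eventually_elim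
      case (elim N)
      show ?case
        unfolding null[symmetric] \<beta>_def VN_def KN_def
        by (rule d_coef_diff_eq_slope[OF decomp[OF nbhd(2)] decomp[OF elim(1)] R2 elim(2) elim(3)[unfolded KN_def]])
    qed
  qed

  let ?B = "B_row i j (R M) (L M) (\<Lambda> M)"
  have s_pos: "s (M, \<Omega>) > 0" and s_eq: "s (M, \<Omega>) = ?B \<bullet> (\<Omega> *v ?B)"
  proof -
    show "s (M, \<Omega>) = ?B \<bullet> (\<Omega> *v ?B)" by (simp add: s_def sigma2_def dot_lmul_matrix)
    then show "s (M, \<Omega>) > 0"
      using Omega_pd B_row_nonzero[OF decomp[OF nbhd(2)] R2 spectra_disjoint]
      by (simp add: positive_definite_def)
  qed
  have \<gamma>_unit: "\<gamma> (M, \<Omega>) \<bullet> (\<Omega> *v \<gamma> (M, \<Omega>)) = 1"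
    using s_pos by (simp add: \<gamma>_def \<beta>M matrix_vector_mult_scaleR flip: s_eq)
  have \<gamma>_cont: "isCont \<gamma> (M, \<Omega>)"
  proof -
    have fst_lim: "(fst \<longlongrightarrow> M) (nhds (M, \<Omega>))" and snd_lim: "(snd \<longlongrightarrow> \<Omega>) (nhds (M, \<Omega>))"
      using tendsto_fst[OF filterlim_ident[of "nhds (M, \<Omega>)"]] tendsto_snd[OF filterlim_ident[of "nhds (M, \<Omega>)"]]
      by simp_all
    have "(s \<longlongrightarrow> s (M, \<Omega>)) (nhds (M, \<Omega>))"
      unfolding s_def fst_conv snd_conv
      by (intro tendsto_sigma2 snd_lim R2 K[unfolded KN_def] filterlim_compose[OF R_lim fst_lim]
          filterlim_compose[OF L_lim fst_lim] filterlim_compose[OF \<Lambda>_lim fst_lim])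
    then have "(\<gamma> \<longlongrightarrow> \<gamma> (M, \<Omega>)) (nhds (M, \<Omega>))"
      unfolding \<gamma>_def fst_conv using s_pos
      by (intro tendsto_intros filterlim_compose[OF \<beta>_lim fst_lim]) auto
    then show ?thesis by (simp add: isCont_def tendsto_at_iff_tendsto_nhds)
  qed

  have \<epsilon>_meas: "\<epsilon> t \<in> borel_measurable P" if "t \<ge> 1" for t
  proof (intro borel_measurable_vecI)
    fix a b
    have "(\<lambda>\<omega>. vec_of (\<epsilon> t \<omega>) $ (b, a)) \<in> borel_measurable P"
      by (rule measurable_compose[OF noise_meas[OF that]], rule borel_measurable_tendsto, intro tendsto_intros)
    then show "(\<lambda>\<omega>. \<epsilon> t \<omega> $ a $ b) \<in> borel_measurable P" by (simp add: vec_of_def)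
  qed
  have Mhat_meas [measurable]: "Mhat T \<in> borel_measurable P" for T
  proof -
    have "Mhat T = (\<lambda>\<omega>. (1 / real T) *\<^sub>R (\<Sum>t=1..T. M + \<epsilon> t \<omega>))"
      by (auto simp: Mhat data intro!: sum.cong)
    moreover have "\<dots> \<in> borel_measurable P"
      using \<epsilon>_meas by (intro borel_measurable_scaleR borel_measurable_const borel_measurable_sum borel_measurable_add) auto
    ultimately show ?thesis by simp
  qed
  have [measurable]: "(vec_of :: real^('r + 'q)^('r + 'q) \<Rightarrow> _) \<in> borel_measurable borel"
    by (rule borel_measurable_tendsto, intro tendsto_intros)
  have Z_meas [measurable]: "Z T \<in> borel_measurable P" for T
    unfolding Z_def by measurable
  note [measurable] = Omegahat_meas hat_meas
  have X_meas: "X T \<in> borel_measurable P" for T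
    unfolding X_def by measurable
  have [measurable]: "(\<lambda>\<omega>. sigma2 i j (R (Mhat T \<omega>)) (L (Mhat T \<omega>)) (\<Lambda> (Mhat T \<omega>)) (\<Omega>hat T \<omega>))
      \<in> borel_measurable P" for T
    by (intro borel_measurable_sigma2) measurable
  have W_meas: "W T \<in> borel_measurable P" for T
    unfolding W_def by measurable

  have conv: "weak_conv_gen (\<lambda>T. distr P borel (Z T)) (mv_normal \<Omega>)"
    unfolding Z_def by (rule clt)
  \<comment> \<open>The limit law inherits total mass 1 from the laws converging to it.\<close>
  have normal: "prob_space (mv_normal \<Omega>)"
    using conv by (rule weak_conv_gen_total_mass) (simp add: prob_space_distr)
  have sets_normal: "sets (mv_normal \<Omega>) = sets borel" by (simp add: mv_normal_def)
  have "consistent_for P Mhat M"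
    by (rule consistent_for_scaled_tight[OF prob Z_meas conv normal sets_normal])
      (simp add: Z_def norm_vec_of dist_norm)
  then have cons: "consistent_for P X (M, \<Omega>)"
    unfolding X_def by (rule consistent_for_Pair[OF prob Mhat_meas Omegahat_meas _ Omegahat])

  have W_eq: "\<forall>\<^sub>F x in nhds (M, \<Omega>). \<forall>T. \<forall>\<omega>\<in>space P. X T \<omega> = x \<longrightarrow> W T \<omega> = \<gamma> x \<bullet> Z T \<omega>"
  proof -
    have "filterlim fst (nhds M) (nhds (M, \<Omega>))"
      using tendsto_fst[OF filterlim_ident[of "nhds (M, \<Omega>)"]] by simp
    from eventually_compose_filterlim[OF slope this]
    show ?thesis
    proof eventually_elim
      case (elim x)
      show ?case
      proof (intro allI ballI impI)
        fix T \<omega> assume x: "X T \<omega> = x"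
        show "W T \<omega> = \<gamma> x \<bullet> Z T \<omega>"
          \<comment> \<open>For \<open>T = 0\<close> both sides are 0: division by 0 gives 0, and so does the factor \<open>sqrt T\<close>.\<close>
          using elim unfolding x[symmetric]
          by (simp add: X_def W_def \<gamma>_def Z_def s_def real_sqrt_divide)
      qed
    qed
  qed
  have "weak_conv_m (\<lambda>T. distr P borel (W T)) (distr (mv_normal \<Omega>) borel (\<lambda>z. \<gamma> (M, \<Omega>) \<bullet> z))"
    by (rule slutsky_inner[OF prob Z_meas conv normal sets_normal X_meas cons \<gamma>_cont W_meas W_eq])
  then show ?thesis
    unfolding distr_inner_mv_normal[OF Omega_pd normal \<gamma>_unit] W_def .
qed

end
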